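(* Let $\mathfrak{n}$ be a nonempty, proper, convex subset of $\mathbb{C}$ and let $\Omega$ be a sesquilinear form on a dense subspace $\mathcal{D}$ of a complex Hilbert space $\mathcal{H}$ which is q-closed with respect to a norm $\|\cdot\|_\Omega$ on $\mathcal{D}$, with numerical range $\mathfrak{n}_\Omega\subseteq\mathfrak{n}$. Assume that one of the following statements holds. (i) If $\{\xi_n\}$ is a sequence in $\mathcal{D}$ such that $\lim_{n\to\infty}\|\xi_n\|=0$ and $\lim_{n\to\infty}|\Omega(\xi_n,\xi_n)|=0$, then $\lim_{n\to\infty}\|\xi_n\|_\Omega=0$. (ii) There exists a bounded sesquilinear form $\Upsilon$ on $\mathcal{H}$ such that $\mathfrak{n}_\Omega\cap(-\mathfrak{n}_\Upsilon)=\varnothing$, where $\mathfrak{n}_\Upsilon$ is the numerical range of $\Upsilon$, and (ii') or (ii'') below holds: (ii') if $\{\xi_n\}$ is a sequence in $\mathcal{D}$ such that $\sup_{\|\eta\|_\Omega=1}|(\Omega+\Upsilon)(\xi_n,\eta)|\to0$, then $\|\xi_n\|_\Omega\to0$; (ii'') there exists a constant $c>0$ such that $c\|\xi\|_\Omega\le\sup_{\|\eta\|_\Omega=1}|(\Omega+\Upsilon)(\xi,\eta)|$ for all $\xi\in\mathcal{D}$. Then $\Omega$ is solvable and its associated operator $T$ is $\mathfrak{n}$-maximal.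
   Context: $\mathcal{H}$ is a complex Hilbert space with inner product $\langle\cdot|\cdot\rangle$ and norm $\|\cdot\|$; $\mathcal{D}$ is a dense subspace of $\mathcal{H}$. An operator $T$ on $\mathcal{H}$ is a linear map from a linear subspace $D(T)\subseteq\mathcal{H}$ to $\mathcal{H}$, and $T\subseteq T'$ means that $T'$ extends $T$. Numerical ranges: $\mathfrak{n}_T=\{\langle T\xi|\xi\rangle:\xi\in D(T),\|\xi\|=1\}$ for an operator, and $\mathfrak{n}_\Omega=\{\Omega(\xi,\xi):\xi\in\mathcal{D},\|\xi\|=1\}$ for a sesquilinear form $\Omega$ on $\mathcal{D}$ (and similarly for forms on $\mathcal{H}$). The suprema in the claim are over $\eta\in\mathcal{D}$. $\mathfrak{n}$-maximality: for a nonempty, convex, proper subset $\mathfrak{n}$ of $\mathbb{C}$, $T$ is $\mathfrak{n}$-maximal if $\mathfrak{n}_T\subseteq\mathfrak{n}$ and whenever $T\subseteq T'$ and $\mathfrak{n}_{T'}\subseteq\mathfrak{n}$, then $T=T'$. q-closed forms: a sesquilinear form $\Omega$ on $\mathcal{D}$ is q-closed with respect to a norm $\|\cdot\|_\Omega$ on $\mathcal{D}$ if (1) there is $\alpha>0$ with $\|\xi\|\le\alpha\|\xi\|_\Omega$ for all $\xi\in\mathcal{D}$; (2) $\mathcal{E}_\Omega:=\mathcal{D}[\|\cdot\|_\Omega]$ (the space $\mathcal{D}$ with norm $\|\cdot\|_\Omega$) is a reflexive Banach space; (3) there is $\beta>0$ with $|\Omega(\xi,\eta)|\le\beta\|\xi\|_\Omega\|\eta\|_\Omega$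 for all $\xi,\eta\in\mathcal{D}$. Solvable forms: let $\Omega$ be q-closed with respect to $\|\cdot\|_\Omega$ and let $\mathcal{E}_\Omega^\times$ be the conjugate dual of $\mathcal{E}_\Omega$ (bounded conjugate-linear functionals $\Lambda$, with action written $\langle\Lambda|\eta\rangle$). $\mathfrak{P}(\Omega)$ is the set of bounded sesquilinear forms $\Upsilon$ on $\mathcal{H}$ such that (1) if $\xi\in\mathcal{D}$ and $(\Omega+\Upsilon)(\xi,\eta)=0$ for all $\eta\in\mathcal{D}$, then $\xi=0$; (2) for every $\Lambda\in\mathcal{E}_\Omega^\times$ there is $\xi\in\mathcal{E}_\Omega$ with $\langle\Lambda|\eta\rangle=(\Omega+\Upsilon)(\xi,\eta)$ for all $\eta\in\mathcal{E}_\Omega$. $\Omega$ is solvable with respect to $\|\cdot\|_\Omega$ if $\mathfrak{P}(\Omega)\ne\varnothing$. Associated operator: $D(T)=\{\xi\in\mathcal{D}:\exists\chi\in\mathcal{H},\ \Omega(\xi,\eta)=\langle\chi|\eta\rangle\ \forall\eta\in\mathcal{D}\}$ and $T\xi=\chi$. *)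

theory Defs
  imports "HOL-Analysis.Analysis" "HOL-Library.Function_Algebras"
begin

section \<open>Complex vector spaces and complex Hilbert spaces\<close>

class complex_vector = ab_group_add +
  fixes scaleC :: "complex \<Rightarrow> 'a \<Rightarrow> 'a"  (infixr \<open>*\<^sub>C\<close> 75)
  assumes scaleC_add_right: "a *\<^sub>C (x + y) = a *\<^sub>C x + a *\<^sub>C y"
    and scaleC_add_left: "(a + b) *\<^sub>C x = a *\<^sub>C x + b *\<^sub>C x"
    and scaleC_scaleC: "a *\<^sub>C (b *\<^sub>C x) = (a * b) *\<^sub>C x"
    and scaleC_one: "1 *\<^sub>C x = x"

global_interpretation complex_vector:
  vector_space "scaleC :: complex \<Rightarrow> 'a \<Rightarrow> 'a::complex_vector"
  by unfold_locales (rule scaleC_add_right scaleC_add_left scaleC_scaleC scaleC_one)+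

abbreviation csubspace :: "'a::complex_vector set \<Rightarrow> bool"
  where "csubspace \<equiv> complex_vector.subspace"

instantiation complex :: complex_vector
begin

definition scaleC_complex :: "complex \<Rightarrow> complex \<Rightarrow> complex"
  where "scaleC_complex a z = a * z"

instance
  by standard (simp_all add: scaleC_complex_def algebra_simps)

end

instantiation "fun" :: (type, complex_vector) complex_vector
begin

definition scaleC_fun :: "complex \<Rightarrow> ('a \<Rightarrow> 'b) \<Rightarrow> 'a \<Rightarrow> 'b"
  where "scaleC_fun a f = (\<lambda>x. a *\<^sub>C f x)"

instance
  by standard
    (simp_all add: scaleC_fun_def fun_eq_iff scaleC_add_right scaleC_add_left
      scaleC_scaleC scaleC_one)

end

text \<open>The inner product is linear in the first and conjugate-linear in the second argument.
  The norm, the metric and the completeness come from \<^class>\<open>banach\<close>; the real scalar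
  multiplication inherited from there is the restriction of the complex one.\<close>

class chilbert_space = banach + complex_vector +
  fixes cinner :: "'a \<Rightarrow> 'a \<Rightarrow> complex"
  assumes scaleR_scaleC: "r *\<^sub>R x = complex_of_real r *\<^sub>C x"
    and cinner_add_left: "cinner (x + y) z = cinner x z + cinner y z"
    and cinner_scaleC_left: "cinner (a *\<^sub>C x) y = a * cinner x y"
    and cinner_commute: "cinner x y = cnj (cinner y x)"
    and cinner_self: "cinner x x = complex_of_real ((norm x)\<^sup>2)"

instantiation complex :: chilbert_space
begin

definition cinner_complex :: "complex \<Rightarrow> complex \<Rightarrow> complex"
  where "cinner_complex x y = x * cnj y"

instance
  by standard
    (simp_all add: cinner_complex_def scaleC_complex_def scaleR_conv_of_real algebra_simps
      flip: complex_norm_square)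

end


section \<open>Normed subspaces, duals and reflexivity\<close>

definition clinear_on :: "'a::complex_vector set \<Rightarrow> ('a \<Rightarrow> 'b::complex_vector) \<Rightarrow> bool"
  where "clinear_on V f \<longleftrightarrow>
    (\<forall>x\<in>V. \<forall>y\<in>V. f (x + y) = f x + f y) \<and> (\<forall>a. \<forall>x\<in>V. f (a *\<^sub>C x) = a *\<^sub>C f x)"

definition conj_linear_on :: "'a::complex_vector set \<Rightarrow> ('a \<Rightarrow> 'b::complex_vector) \<Rightarrow> bool"
  where "conj_linear_on V f \<longleftrightarrow>
    (\<forall>x\<in>V. \<forall>y\<in>V. f (x + y) = f x + f y) \<and> (\<forall>a. \<forall>x\<in>V. f (a *\<^sub>C x) = cnj a *\<^sub>C f x)"

definition norm_on :: "'a::complex_vector set \<Rightarrow> ('a \<Rightarrow> real) \<Rightarrow> bool"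
  where "norm_on V N \<longleftrightarrow>
    (\<forall>x\<in>V. 0 \<le> N x) \<and>
    (\<forall>x\<in>V. N x = 0 \<longleftrightarrow> x = 0) \<and>
    (\<forall>x\<in>V. \<forall>y\<in>V. N (x + y) \<le> N x + N y) \<and>
    (\<forall>a. \<forall>x\<in>V. N (a *\<^sub>C x) = cmod a * N x)"

definition complete_on :: "'a::complex_vector set \<Rightarrow> ('a \<Rightarrow> real) \<Rightarrow> bool"
  where "complete_on V N \<longleftrightarrow>
    (\<forall>X :: nat \<Rightarrow> 'a.
      (\<forall>n. X n \<in> V) \<longrightarrow>
      (\<forall>e>0. \<exists>M. \<forall>m\<ge>M. \<forall>n\<ge>M. N (X m - X n) < e) \<longrightarrow>
      (\<exists>x\<in>V. (\<lambda>n. N (X n - x)) \<longlonglongrightarrow> 0))"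

definition bounded_on :: "'a set \<Rightarrow> ('a \<Rightarrow> real) \<Rightarrow> ('a \<Rightarrow> complex) \<Rightarrow> bool"
  where "bounded_on V N f \<longleftrightarrow> (\<exists>C. \<forall>x\<in>V. cmod (f x) \<le> C * N x)"

text \<open>A functional on \<open>V\<close> is represented by the total function that is \<open>0\<close> outside \<open>V\<close>,
  so that equal functionals are equal as HOL functions.\<close>

definition dual_space ::
    "'a::complex_vector set \<Rightarrow> ('a \<Rightarrow> real) \<Rightarrow> ('a \<Rightarrow> complex) set"
  where "dual_space V N = {f. clinear_on V f \<and> bounded_on V N f \<and> (\<forall>x. x \<notin> V \<longrightarrow> f x = 0)}"

definition conj_dual_space ::
    "'a::complex_vector set \<Rightarrow> ('a \<Rightarrow> real) \<Rightarrow> ('a \<Rightarrow> complex) set"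
  where "conj_dual_space V N =
    {f. conj_linear_on V f \<and> bounded_on V N f \<and> (\<forall>x. x \<notin> V \<longrightarrow> f x = 0)}"

definition dual_norm :: "'a set \<Rightarrow> ('a \<Rightarrow> real) \<Rightarrow> ('a \<Rightarrow> complex) \<Rightarrow> real"
  where "dual_norm V N f = (SUP x\<in>{x \<in> V. N x \<le> 1}. cmod (f x))"

text \<open>The canonical embedding into the bidual, sending \<open>x\<close> to evaluation at \<open>x\<close>, is onto.\<close>

definition reflexive_on :: "'a::complex_vector set \<Rightarrow> ('a \<Rightarrow> real) \<Rightarrow> bool"
  where "reflexive_on V N \<longleftrightarrow>
    (\<forall>\<Phi>\<in>dual_space (dual_space V N) (dual_norm V N). \<exists>x\<in>V. \<forall>f\<in>dual_space V N. \<Phi> f = f x)"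


section \<open>Sesquilinear forms\<close>

definition sesquilinear_on ::
    "'a::complex_vector set \<Rightarrow> ('a \<Rightarrow> 'a \<Rightarrow> complex) \<Rightarrow> bool"
  where "sesquilinear_on V \<Omega> \<longleftrightarrow>
    (\<forall>\<eta>\<in>V. clinear_on V (\<lambda>\<xi>. \<Omega> \<xi> \<eta>)) \<and> (\<forall>\<xi>\<in>V. conj_linear_on V (\<lambda>\<eta>. \<Omega> \<xi> \<eta>))"

definition bounded_sesquilinear :: "('h::chilbert_space \<Rightarrow> 'h \<Rightarrow> complex) \<Rightarrow> bool"
  where "bounded_sesquilinear \<Upsilon> \<longleftrightarrow>
    sesquilinear_on UNIV \<Upsilon> \<and> (\<exists>C. \<forall>\<xi> \<eta>. cmod (\<Upsilon> \<xi> \<eta>) \<le> C * norm \<xi> * norm \<eta>)"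

definition form_numerical_range :: "'h::chilbert_space set \<Rightarrow> ('h \<Rightarrow> 'h \<Rightarrow> complex) \<Rightarrow> complex set"
  where "form_numerical_range V \<Omega> = {\<Omega> \<xi> \<xi> |\<xi>. \<xi> \<in> V \<and> norm \<xi> = 1}"

definition q_closed ::
    "'h::chilbert_space set \<Rightarrow> ('h \<Rightarrow> 'h \<Rightarrow> complex) \<Rightarrow> ('h \<Rightarrow> real) \<Rightarrow> bool"
  where "q_closed \<D> \<Omega> N \<longleftrightarrow>
    (\<exists>\<alpha>>0. \<forall>\<xi>\<in>\<D>. norm \<xi> \<le> \<alpha> * N \<xi>) \<and>
    complete_on \<D> N \<and> reflexive_on \<D> N \<and>
    (\<exists>\<beta>>0. \<forall>\<xi>\<in>\<D>. \<forall>\<eta>\<in>\<D>. cmod (\<Omega> \<xi> \<eta>) \<le> \<beta> * N \<xi> * N \<eta>)"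

definition solving_perturbations ::
    "'h::chilbert_space set \<Rightarrow> ('h \<Rightarrow> 'h \<Rightarrow> complex) \<Rightarrow> ('h \<Rightarrow> real) \<Rightarrow>
      ('h \<Rightarrow> 'h \<Rightarrow> complex) set"
  where "solving_perturbations \<D> \<Omega> N =
    {\<Upsilon>. bounded_sesquilinear \<Upsilon> \<and>
      (\<forall>\<xi>\<in>\<D>. (\<forall>\<eta>\<in>\<D>. \<Omega> \<xi> \<eta> + \<Upsilon> \<xi> \<eta> = 0) \<longrightarrow> \<xi> = 0) \<and>
      (\<forall>\<Lambda>\<in>conj_dual_space \<D> N. \<exists>\<xi>\<in>\<D>. \<forall>\<eta>\<in>\<D>. \<Lambda> \<eta> = \<Omega> \<xi> \<eta> + \<Upsilon> \<xi> \<eta>)}"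

definition solvable ::
    "'h::chilbert_space set \<Rightarrow> ('h \<Rightarrow> 'h \<Rightarrow> complex) \<Rightarrow> ('h \<Rightarrow> real) \<Rightarrow> bool"
  where "solvable \<D> \<Omega> N \<longleftrightarrow> q_closed \<D> \<Omega> N \<and> solving_perturbations \<D> \<Omega> N \<noteq> {}"


section \<open>Operators\<close>

text \<open>An operator is a partial function, so \<open>T \<subseteq>\<^sub>m T'\<close> says that \<open>T'\<close> extends \<open>T\<close>, and
  equality of operators, domains included, is HOL equality.\<close>

definition linear_operator :: "('h::chilbert_space \<rightharpoonup> 'h) \<Rightarrow> bool"
  where "linear_operator T \<longleftrightarrow> csubspace (dom T) \<and> clinear_on (dom T) (\<lambda>\<xi>. the (T \<xi>))"

definition operator_numerical_range :: "('h::chilbert_space \<rightharpoonup> 'h) \<Rightarrow> complex set"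
  where "operator_numerical_range T = {cinner (the (T \<xi>)) \<xi> |\<xi>. \<xi> \<in> dom T \<and> norm \<xi> = 1}"

definition maximal_operator :: "complex set \<Rightarrow> ('h::chilbert_space \<rightharpoonup> 'h) \<Rightarrow> bool"
  where "maximal_operator \<nn> T \<longleftrightarrow>
    linear_operator T \<and> operator_numerical_range T \<subseteq> \<nn> \<and>
    (\<forall>T'. linear_operator T' \<longrightarrow> T \<subseteq>\<^sub>m T' \<longrightarrow> operator_numerical_range T' \<subseteq> \<nn> \<longrightarrow> T = T')"

text \<open>The vector \<open>\<zeta>\<close> below is unique because \<open>\<D>\<close> is dense.\<close>

definition associated_operator ::
    "'h::chilbert_space set \<Rightarrow> ('h \<Rightarrow> 'h \<Rightarrow> complex) \<Rightarrow> ('h \<rightharpoonup> 'h)"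
  where "associated_operator \<D> \<Omega> = (\<lambda>\<xi>.
    if \<xi> \<in> \<D> \<and> (\<exists>\<zeta>. \<forall>\<eta>\<in>\<D>. \<Omega> \<xi> \<eta> = cinner \<zeta> \<eta>)
    then Some (THE \<zeta>. \<forall>\<eta>\<in>\<D>. \<Omega> \<xi> \<eta> = cinner \<zeta> \<eta>) else None)"

end

theory Submission
  imports Defs
begin

text \<open>
  A proper convex subset of the plane is not dense, so there is a point \<open>l\<close> at a distance
  \<open>d > 0\<close> from \<open>\<nn>\<close>. The form \<open>\<Psi> = \<Omega> - l\<langle>\<cdot>|\<cdot>\<rangle>\<close> then satisfies
  \<open>d \<parallel>\<xi>\<parallel>\<^sup>2 \<le> \<bar>\<Psi>(\<xi>,\<xi>)\<bar>\<close>, and the shift by \<open>l\<close> serves both claims: \<open>- l\<langle>\<cdot>|\<cdot>\<rangle>\<close>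
  is the perturbation that shows \<open>\<Omega>\<close> to be solvable, and \<open>T - l\<close> the operator that shows \<open>T\<close> to be
  maximal.

  To see that \<open>\<xi> \<mapsto> \<Psi>(\<xi>,\<cdot>)\<close> is bounded below as a map from \<open>\<D>\<close> with the norm of \<open>\<Omega>\<close> to its
  conjugate dual (\<open>shifted_form_bounded_below\<close>), suppose that it sends unit vectors \<open>\<xi>\<^sub>n\<close> to
  functionals that tend to \<open>0\<close>. Then \<open>\<Psi>(\<xi>\<^sub>n,\<xi>\<^sub>n) \<longlonglongrightarrow> 0\<close>, so \<open>\<parallel>\<xi>\<^sub>n\<parallel> \<longlonglongrightarrow> 0\<close> by the estimate. A form
  that is bounded on the Hilbert space contributes a null sequence of functionals along \<open>\<xi>\<^sub>n\<close>;
  hence \<open>\<Omega>(\<xi>\<^sub>n,\<cdot>)\<close> and \<open>(\<Omega> + \<Upsilon>)(\<xi>\<^sub>n,\<cdot>)\<close> tend to \<open>0\<close> as well, and each of the alternatives in the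
  hypothesis contradicts that the \<open>\<xi>\<^sub>n\<close> are unit vectors.

  A bounded form on a reflexive space that is bounded below has closed range in the conjugate
  dual. If the range were proper, the Hahn--Banach theorem and reflexivity would give
  \<open>\<eta> \<noteq> 0\<close> with \<open>\<Psi>(\<xi>,\<eta>) = 0\<close> for all \<open>\<xi>\<close>, which is impossible since \<open>\<Psi>(\<eta>,\<eta>) \<noteq> 0\<close>. So every
  functional is some \<open>\<Psi>(\<xi>,\<cdot>)\<close> (\<open>reflexive_form_surjective\<close>), and \<open>\<Omega>\<close> is solvable.

  Applied to the functionals \<open>\<langle>\<kappa>|\<cdot>\<rangle>\<close>, surjectivity says that \<open>T - l\<close> maps onto the Hilbert space. An
  extension \<open>T'\<close> of \<open>T\<close> with numerical range in \<open>\<nn>\<close> does not have the eigenvalue \<open>l\<close>, so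
  \<open>T' - l\<close> is an injective extension of a surjective map and \<open>T' = T\<close> (\<open>maximal_operatorI\<close>).

  The Hahn--Banach theorem is obtained from minimal sublinear functionals: such a functional is
  linear, and lowering a given one along a cone first yields any compatible lower bounds.
\<close>

section \<open>Sublinear functionals and the Hahn--Banach theorem\<close>

text \<open>Homogeneity is stated as an inequality because that is what passes to infima; applied
  to \<open>t\<close> and to \<open>1 / t\<close> it gives equality.\<close>

definition sublinear_on :: "'a::complex_vector set \<Rightarrow> ('a \<Rightarrow> real) \<Rightarrow> bool"
  where "sublinear_on V q \<longleftrightarrow>
    (\<forall>x\<in>V. \<forall>y\<in>V. q (x + y) \<le> q x + q y) \<and>
    (\<forall>t>0. \<forall>x\<in>V. q (complex_of_real t *\<^sub>C x) \<le> t * q x)"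

lemma sublinear_on_add: "sublinear_on V q \<Longrightarrow> x \<in> V \<Longrightarrow> y \<in> V \<Longrightarrow> q (x + y) \<le> q x + q y"
  by (simp add: sublinear_on_def)

lemma sublinear_on_scale:
  assumes V: "csubspace V" and q: "sublinear_on V q" and t: "t > 0" and x: "x \<in> V"
  shows "q (complex_of_real t *\<^sub>C x) = t * q x"
proof (rule antisym)
  show "q (complex_of_real t *\<^sub>C x) \<le> t * q x"
    using q t x by (simp add: sublinear_on_def)
  have "complex_of_real t *\<^sub>C x \<in> V"
    using V x by (rule complex_vector.subspace_scale)
  then have "q (complex_of_real (1/t) *\<^sub>C complex_of_real t *\<^sub>C x)
      \<le> (1/t) * q (complex_of_real t *\<^sub>C x)"
    using q t unfolding sublinear_on_def by (meson divide_pos_pos zero_less_one)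
  also have "complex_of_real (1/t) *\<^sub>C complex_of_real t *\<^sub>C x = x"
    using t by (simp add: scaleC_scaleC scaleC_one flip: of_real_mult)
  finally show "t * q x \<le> q (complex_of_real t *\<^sub>C x)"
    using t by (simp add: field_simps)
qed

lemma sublinear_on_zero:
  assumes "csubspace V" and "sublinear_on V q"
  shows "q 0 = 0"
  using sublinear_on_scale[OF assms, of 2 0] complex_vector.subspace_0[OF assms(1)] by simp

text \<open>From \<open>y = (x + y) + (-x)\<close>. With \<open>q = p\<close> it bounds from below all translates that enter an
  infimum, and with \<open>y = 0\<close> it bounds all sublinear functionals below \<open>p\<close> at once.\<close>

lemma sublinear_on_lower_bound:
  assumes V: "csubspace V" and q: "sublinear_on V q" and le: "\<And>x. x \<in> V \<Longrightarrow> q x \<le> p x"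
    and x: "x \<in> V" and y: "y \<in> V"
  shows "- p (- x) + q y \<le> q (x + y)"
proof -
  have "- x \<in> V" "x + y \<in> V"
    using V x y by (auto intro: complex_vector.subspace_neg complex_vector.subspace_add)
  then have "q (x + y + - x) \<le> q (x + y) + q (- x)"
    using q by (intro sublinear_on_add)
  moreover have "x + y + - x = y" by simp
  ultimately show ?thesis
    using le[OF \<open>- x \<in> V\<close>] by simp
qed

text \<open>The one infimum argument behind both \<open>sublinear_on_tilt\<close> (translates along a cone) and the
  lower bounds of chains needed for Zorn's lemma. In both families two members can be combined
  into a third one, which is what the infimum of a sum needs.\<close>

lemma sublinear_on_INF:
  fixes \<F> :: "('a::complex_vector \<Rightarrow> real) set"
  assumes V: "csubspace V" and ne: "\<F> \<noteq> {}"
    and lower: "\<And>f x. f \<in> \<F> \<Longrightarrow> x \<in> V \<Longrightarrow> b x \<le> f x"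
    and add: "\<And>f g x y. f \<in> \<F> \<Longrightarrow> g \<in> \<F> \<Longrightarrow> x \<in> V \<Longrightarrow> y \<in> V \<Longrightarrow>
      \<exists>h\<in>\<F>. h (x + y) \<le> f x + g y"
    and scale: "\<And>f t x. f \<in> \<F> \<Longrightarrow> t > 0 \<Longrightarrow> x \<in> V \<Longrightarrow>
      \<exists>h\<in>\<F>. h (complex_of_real t *\<^sub>C x) \<le> t * f x"
  shows "sublinear_on V (\<lambda>x. if x \<in> V then INF f\<in>\<F>. f x else 0)"
proof -
  define m where "m x = (INF f\<in>\<F>. f x)" for x
  have m_le: "m x \<le> f x" if "f \<in> \<F>" "x \<in> V" for f x
    unfolding m_def using that lower by (intro cINF_lower bdd_belowI2) auto
  have le_m: "a \<le> m x" if "\<And>f. f \<in> \<F> \<Longrightarrow> a \<le> f x" for a x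
    unfolding m_def using ne that by (intro cINF_greatest)
  have "m (x + y) \<le> m x + m y" if "x \<in> V" "y \<in> V" for x y
  proof -
    have xy: "x + y \<in> V" using V that by (rule complex_vector.subspace_add)
    have "m (x + y) \<le> f x + g y" if "f \<in> \<F>" "g \<in> \<F>" for f g
      using add[OF that \<open>x \<in> V\<close> \<open>y \<in> V\<close>] m_le[OF _ xy] by force
    then have "m (x + y) - f x \<le> m y" if "f \<in> \<F>" for f
      using that by (intro le_m) (force simp: algebra_simps)
    then have "m (x + y) - m y \<le> m x"
      by (intro le_m) (simp add: algebra_simps)
    then show ?thesis by simp
  qed
  moreover have "m (complex_of_real t *\<^sub>C x) \<le> t * m x" if "t > 0" "x \<in> V" for t x
  proof -
    have tx: "complex_of_real t *\<^sub>C x \<in> V" using V that by (intro complex_vector.subspace_scale)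
    have "m (complex_of_real t *\<^sub>C x) \<le> t * f x" if "f \<in> \<F>" for f
      using scale[OF that \<open>t > 0\<close> \<open>x \<in> V\<close>] m_le[OF _ tx] by force
    then have "m (complex_of_real t *\<^sub>C x) / t \<le> m x"
      using \<open>t > 0\<close> by (intro le_m) (simp add: field_simps)
    then show ?thesis using \<open>t > 0\<close> by (simp add: field_simps)
  qed
  ultimately show ?thesis
    using V unfolding sublinear_on_def m_def[symmetric]
    by (simp add: complex_vector.subspace_add complex_vector.subspace_scale)
qed

text \<open>A pair \<open>(c, s)\<close> in the cone stands for the demand that the functional be at least \<open>s\<close> at \<open>c\<close>.
  The functional \<open>q x = inf (p (x + c) - s)\<close> enforces all demands for every linear functional
  below it, since \<open>q (-c) \<le> p 0 - s\<close>. That no demand exceeds \<open>p\<close> keeps the infimum finite.\<close>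

lemma sublinear_on_tilt:
  fixes C :: "('a::complex_vector \<times> real) set"
  assumes V: "csubspace V" and p: "sublinear_on V p" and CV: "fst ` C \<subseteq> V"
    and zero: "(0, 0) \<in> C"
    and add: "\<And>c s c' s'. (c, s) \<in> C \<Longrightarrow> (c', s') \<in> C \<Longrightarrow> (c + c', s + s') \<in> C"
    and scale: "\<And>t c s. t > 0 \<Longrightarrow> (c, s) \<in> C \<Longrightarrow> (complex_of_real t *\<^sub>C c, t * s) \<in> C"
    and le: "\<And>c s. (c, s) \<in> C \<Longrightarrow> s \<le> p c"
  obtains q where "sublinear_on V q" "\<And>x. x \<in> V \<Longrightarrow> q x \<le> p x"
    "\<And>c s. (c, s) \<in> C \<Longrightarrow> q (- c) \<le> - s"
proof -
  define \<F> where "\<F> = (\<lambda>(c, s) x. p (x + c) - s) ` C"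
  define q where "q = (\<lambda>x. if x \<in> V then INF f\<in>\<F>. f x else 0)"
  have \<F>I: "(\<lambda>x. p (x + c) - s) \<in> \<F>" if "(c, s) \<in> C" for c s
    using that unfolding \<F>_def by force
  have \<F>E: "\<exists>c s. (c, s) \<in> C \<and> c \<in> V \<and> f = (\<lambda>x. p (x + c) - s)" if "f \<in> \<F>" for f
    using that CV unfolding \<F>_def by force
  have lower: "- p (- x) \<le> f x" if "f \<in> \<F>" "x \<in> V" for f x
  proof -
    obtain c s where c: "(c, s) \<in> C" "c \<in> V" "f = (\<lambda>x. p (x + c) - s)"
      using \<F>E[OF \<open>f \<in> \<F>\<close>] by blast
    show ?thesis
      using sublinear_on_lower_bound[OF V p order_refl \<open>x \<in> V\<close> \<open>c \<in> V\<close>] le[OF c(1)] c(3) by simp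
  qed
  have "sublinear_on V q"
    unfolding q_def
  proof (rule sublinear_on_INF[where b = "\<lambda>x. - p (- x)", OF V])
    show "\<F> \<noteq> {}" using \<F>I[OF zero] by auto
  next
    fix f g x y assume fg: "f \<in> \<F>" "g \<in> \<F>" and xy: "x \<in> V" "y \<in> V"
    obtain c s c' s' where c: "(c, s) \<in> C" "c \<in> V" "f = (\<lambda>x. p (x + c) - s)"
      and c': "(c', s') \<in> C" "c' \<in> V" "g = (\<lambda>x. p (x + c') - s')"
      using fg \<F>E by meson
    have "p ((x + c) + (y + c')) \<le> p (x + c) + p (y + c')"
      using V p xy c c' by (intro sublinear_on_add[OF p] complex_vector.subspace_add)
    moreover have "(x + c) + (y + c') = x + y + (c + c')" by simp
    ultimately show "\<exists>h\<in>\<F>. h (x + y) \<le> f x + g y"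
      using \<F>I[OF add[OF c(1) c'(1)]] c(3) c'(3) by (intro bexI) auto
  next
    fix f t x assume f: "f \<in> \<F>" and t: "t > (0::real)" and x: "x \<in> V"
    obtain c s where c: "(c, s) \<in> C" "c \<in> V" "f = (\<lambda>x. p (x + c) - s)"
      using f \<F>E by meson
    have "p (complex_of_real t *\<^sub>C (x + c)) = t * p (x + c)"
      using V x c by (intro sublinear_on_scale[OF V p t] complex_vector.subspace_add)
    then show "\<exists>h\<in>\<F>. h (complex_of_real t *\<^sub>C x) \<le> t * f x"
      using \<F>I[OF scale[OF t c(1)]] c(3)
      by (intro bexI) (auto simp: scaleC_add_right right_diff_distrib)
  qed (use lower in auto)
  moreover have q_le: "q x \<le> f x" if "x \<in> V" "f \<in> \<F>" for x f
    using that lower unfolding q_def by (auto intro!: cINF_lower bdd_belowI2)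
  have "q x \<le> p x" if "x \<in> V" for x
    using q_le[OF that \<F>I[OF zero]] by simp
  moreover have "q (- c) \<le> - s" if c: "(c, s) \<in> C" for c s
  proof -
    have "- c \<in> V" using c CV V by (force intro: complex_vector.subspace_neg)
    then show ?thesis
      using q_le[OF _ \<F>I[OF c], of "- c"] sublinear_on_zero[OF V p] by simp
  qed
  ultimately show ?thesis by (rule that)
qed

text \<open>Only values on \<open>V\<close> matter, but antisymmetry in Zorn's lemma needs equality of functions, so the
  functionals are cut off to \<open>0\<close> outside \<open>V\<close>.\<close>

lemma minimal_sublinear_on:
  assumes V: "csubspace V" and p: "sublinear_on V p"
  obtains q where "sublinear_on V q" "\<And>x. x \<in> V \<Longrightarrow> q x \<le> p x"
    "\<And>q' x. sublinear_on V q' \<Longrightarrow> (\<And>x. x \<in> V \<Longrightarrow> q' x \<le> q x) \<Longrightarrow> x \<in> V \<Longrightarrow> q' x = q x"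
proof -
  define cut where "cut q x = (if x \<in> V then q x else 0)" for q :: "'a \<Rightarrow> real" and x
  have cut: "sublinear_on V (cut q) \<longleftrightarrow> sublinear_on V q" for q
    using V unfolding sublinear_on_def cut_def
    by (simp add: complex_vector.subspace_add complex_vector.subspace_scale)
  define A where "A = {q. sublinear_on V q \<and> (\<forall>x\<in>V. q x \<le> p x) \<and> (\<forall>x. x \<notin> V \<longrightarrow> q x = 0)}"
  define P :: "('a \<Rightarrow> real) \<Rightarrow> ('a \<Rightarrow> real) \<Rightarrow> bool" where "P q q' \<longleftrightarrow> (\<forall>x. q' x \<le> q x)" for q q'
  have "\<exists>m\<in>A. \<forall>a\<in>A. P m a \<longrightarrow> a = m"
  proof (rule predicate_Zorn)
    show "partial_order_on A (relation_of P A)"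
      by (rule partial_order_on_relation_ofI) (auto simp: P_def fun_eq_iff intro: order_trans antisym)
  next
    fix C assume "C \<in> Chains (relation_of P A)"
    then have CA: "C \<subseteq> A" and chain: "\<And>f g. f \<in> C \<Longrightarrow> g \<in> C \<Longrightarrow> P f g \<or> P g f"
      by (auto simp: Chains_def relation_of_def)
    show "\<exists>u\<in>A. \<forall>a\<in>C. P a u"
    proof (cases "C = {}")
      case True
      have "cut p \<in> A" using p cut unfolding A_def by (auto simp: cut_def)
      then show ?thesis using True by auto
    next
      case False
      define u where "u = (\<lambda>x. if x \<in> V then INF f\<in>C. f x else 0)"
      have lower: "- p (- x) \<le> f x" if "f \<in> C" "x \<in> V" for f x
      proof -
        have "sublinear_on V f" "\<And>x. x \<in> V \<Longrightarrow> f x \<le> p x"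
          using CA that by (auto simp: A_def)
        then show ?thesis
          using sublinear_on_lower_bound[OF V _ _ \<open>x \<in> V\<close> complex_vector.subspace_0[OF V]]
            sublinear_on_zero[OF V] by fastforce
      qed
      have u_le: "u x \<le> f x" if "f \<in> C" "x \<in> V" for f x
        using that lower unfolding u_def by (auto intro!: cINF_lower bdd_belowI2)
      have "sublinear_on V u"
        unfolding u_def
      proof (rule sublinear_on_INF[where b = "\<lambda>x. - p (- x)", OF V False])
        fix f g x y assume fg: "f \<in> C" "g \<in> C" and xy: "x \<in> V" "y \<in> V"
        obtain h where h: "h \<in> C" "\<And>x. h x \<le> f x" "\<And>x. h x \<le> g x"
          using chain[OF fg] fg unfolding P_def by blast
        have "h (x + y) \<le> h x + h y"
          using h(1) CA xy by (auto simp: A_def sublinear_on_def)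
        also have "\<dots> \<le> f x + g y" using h by (intro add_mono) auto
        finally show "\<exists>h\<in>C. h (x + y) \<le> f x + g y" using h(1) by blast
      next
        fix f t x assume "f \<in> C" "t > (0::real)" "x \<in> V"
        then show "\<exists>h\<in>C. h (complex_of_real t *\<^sub>C x) \<le> t * f x"
          using CA by (intro bexI[of _ f]) (auto simp: A_def sublinear_on_def)
      qed (use lower in auto)
      moreover have "u x \<le> p x" if "x \<in> V" for x
      proof -
        obtain f where "f \<in> C" using False by auto
        then show ?thesis using u_le[OF _ that] CA that by (force simp: A_def)
      qed
      ultimately have "u \<in> A" by (simp add: A_def u_def)
      moreover have "P a u" if "a \<in> C" for a
        using that u_le CA unfolding P_def by (force simp: A_def u_def)
      ultimately show ?thesis by blast
    qed
  qed
  then obtain q where q: "q \<in> A" and min: "\<And>a. a \<in> A \<Longrightarrow> P q a \<Longrightarrow> a = q" by blast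
  show ?thesis
  proof (rule that[of q])
    show "sublinear_on V q" using q by (simp add: A_def)
    show "q x \<le> p x" if "x \<in> V" for x using q that by (simp add: A_def)
    fix q' x assume q': "sublinear_on V q'" "\<And>x. x \<in> V \<Longrightarrow> q' x \<le> q x" and x: "x \<in> V"
    have "q' y \<le> p y" if "y \<in> V" for y
      using q'(2)[OF that] q that by (force simp: A_def)
    then have "cut q' \<in> A" "P q (cut q')"
      using q' cut[of q'] q by (auto simp: A_def P_def cut_def)
    then have "cut q' = q" by (rule min)
    then have "cut q' x = q x" by simp
    then show "q' x = q x"
      using x by (simp add: cut_def)
  qed
qed

text \<open>Lower \<open>p\<close> along \<open>C\<close> and take a minimal sublinear \<open>g\<close> below the result. Lowering \<open>g\<close> once more,
  along the ray of a single \<open>x\<close> with the demand \<open>g x\<close>, changes nothing by minimality but forces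
  \<open>g (-x) \<le> - g x\<close>. An odd sublinear functional is linear.\<close>

theorem Hahn_Banach_cone:
  fixes C :: "('a::complex_vector \<times> real) set"
  assumes V: "csubspace V" and p: "sublinear_on V p" and CV: "fst ` C \<subseteq> V"
    and zero: "(0, 0) \<in> C"
    and add: "\<And>c s c' s'. (c, s) \<in> C \<Longrightarrow> (c', s') \<in> C \<Longrightarrow> (c + c', s + s') \<in> C"
    and scale: "\<And>t c s. t > 0 \<Longrightarrow> (c, s) \<in> C \<Longrightarrow> (complex_of_real t *\<^sub>C c, t * s) \<in> C"
    and le: "\<And>c s. (c, s) \<in> C \<Longrightarrow> s \<le> p c"
  obtains g :: "'a \<Rightarrow> real" where
    "\<And>x y. x \<in> V \<Longrightarrow> y \<in> V \<Longrightarrow> g (x + y) = g x + g y"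
    "\<And>t x. x \<in> V \<Longrightarrow> g (complex_of_real t *\<^sub>C x) = t * g x"
    "\<And>x. x \<in> V \<Longrightarrow> g x \<le> p x"
    "\<And>c s. (c, s) \<in> C \<Longrightarrow> s \<le> g c"
proof -
  obtain p' where p': "sublinear_on V p'" "\<And>x. x \<in> V \<Longrightarrow> p' x \<le> p x"
    "\<And>c s. (c, s) \<in> C \<Longrightarrow> p' (- c) \<le> - s"
    using sublinear_on_tilt[OF V p CV zero add scale le] by metis
  obtain g where g: "sublinear_on V g" "\<And>x. x \<in> V \<Longrightarrow> g x \<le> p' x"
    and min: "\<And>q x. sublinear_on V q \<Longrightarrow> (\<And>x. x \<in> V \<Longrightarrow> q x \<le> g x) \<Longrightarrow> x \<in> V \<Longrightarrow> q x = g x"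
    using minimal_sublinear_on[OF V p'(1)] by metis
  have neg_V: "- x \<in> V" if "x \<in> V" for x
    using V that by (rule complex_vector.subspace_neg)
  have odd: "g (- x) = - g x" if x: "x \<in> V" for x
  proof (rule antisym)
    define D where "D = {(complex_of_real t *\<^sub>C x, t * g x) |t. t \<ge> 0}"
    have CI: "(complex_of_real t *\<^sub>C x, t * g x) \<in> D" if "t \<ge> 0" for t
      using that unfolding D_def by blast
    have CE: "\<exists>t\<ge>0. c = complex_of_real t *\<^sub>C x \<and> s = t * g x" if "(c, s) \<in> D" for c s
      using that unfolding D_def by blast
    obtain q where q: "sublinear_on V q" "\<And>x. x \<in> V \<Longrightarrow> q x \<le> g x"
      "\<And>c s. (c, s) \<in> D \<Longrightarrow> q (- c) \<le> - s"
    proof (rule sublinear_on_tilt[OF V g(1), of D])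
      show "fst ` D \<subseteq> V" using V x unfolding D_def by (auto intro: complex_vector.subspace_scale)
      show "(0, 0) \<in> D" using CI[of 0] by simp
      show "(c + c', s + s') \<in> D" if "(c, s) \<in> D" "(c', s') \<in> D" for c s c' s'
      proof -
        obtain t t' where "t \<ge> 0" "c = complex_of_real t *\<^sub>C x" "s = t * g x"
          "t' \<ge> 0" "c' = complex_of_real t' *\<^sub>C x" "s' = t' * g x"
          using CE[OF \<open>(c, s) \<in> D\<close>] CE[OF \<open>(c', s') \<in> D\<close>] by blast
        then show ?thesis
          using CI[of "t + t'"] by (simp only: scaleC_add_left distrib_right of_real_add add_nonneg_nonneg)
      qed
      show "(complex_of_real t *\<^sub>C c, t * s) \<in> D" if "t > 0" "(c, s) \<in> D" for t c s
      proof -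
        obtain t' where "t' \<ge> 0" "c = complex_of_real t' *\<^sub>C x" "s = t' * g x"
          using CE[OF \<open>(c, s) \<in> D\<close>] by blast
        then show ?thesis
          using \<open>t > 0\<close> CI[of "t * t'"] by (simp add: scaleC_scaleC mult.assoc)
      qed
      show "s \<le> g c" if "(c, s) \<in> D" for c s
      proof -
        obtain t where t: "t \<ge> 0" "c = complex_of_real t *\<^sub>C x" "s = t * g x"
          using CE[OF \<open>(c, s) \<in> D\<close>] by blast
        then show ?thesis
          using sublinear_on_scale[OF V g(1) _ x, of t] sublinear_on_zero[OF V g(1)]
          by (cases "t = 0") auto
      qed
    qed (rule that)
    have "(x, g x) \<in> D" using CI[of 1] by (simp add: scaleC_one)
    then have "q (- x) \<le> - g x" by (rule q(3))
    then show "g (- x) \<le> - g x" using min[OF q(1,2) neg_V[OF x]] by simp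
    have "g (x + - x) \<le> g x + g (- x)"
      using x neg_V by (intro sublinear_on_add[OF g(1)])
    then show "- g x \<le> g (- x)" using sublinear_on_zero[OF V g(1)] by simp
  qed
  show ?thesis
  proof (rule that[of g])
    show "g (x + y) = g x + g y" if "x \<in> V" "y \<in> V" for x y
    proof (rule antisym)
      show "g (x + y) \<le> g x + g y" using that by (rule sublinear_on_add[OF g(1)])
      show "g x + g y \<le> g (x + y)"
        using sublinear_on_lower_bound[OF V g(1) order_refl that] odd[OF that(1)] by simp
    qed
    show "g (complex_of_real t *\<^sub>C x) = t * g x" if x: "x \<in> V" for t x
    proof (rule linorder_cases[of t 0])
      assume "t < 0"
      then have "g (complex_of_real (- t) *\<^sub>C (- x)) = - t * g (- x)"
        using x neg_V by (intro sublinear_on_scale[OF V g(1)]) auto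
      then show ?thesis using odd[OF x] by simp
    qed (use sublinear_on_scale[OF V g(1) _ x] sublinear_on_zero[OF V g(1)] in auto)
    show "g x \<le> p x" if "x \<in> V" for x using g(2) p'(2) that by force
    show "s \<le> g c" if "(c, s) \<in> C" for c s
    proof -
      have "c \<in> V" using that CV by force
      then show ?thesis using odd g(2)[of "- c"] p'(3)[OF that] neg_V by force
    qed
  qed
qed

lemma norm_on_nonneg: "norm_on V N \<Longrightarrow> x \<in> V \<Longrightarrow> 0 \<le> N x"
  and norm_on_eq_0: "norm_on V N \<Longrightarrow> x \<in> V \<Longrightarrow> N x = 0 \<longleftrightarrow> x = 0"
  and norm_on_triangle: "norm_on V N \<Longrightarrow> x \<in> V \<Longrightarrow> y \<in> V \<Longrightarrow> N (x + y) \<le> N x + N y"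
  and norm_on_scale: "norm_on V N \<Longrightarrow> x \<in> V \<Longrightarrow> N (a *\<^sub>C x) = cmod a * N x"
  by (simp_all add: norm_on_def)

text \<open>The demands are \<open>0\<close> on \<open>R\<close>, hence the value \<open>0\<close> there because \<open>R\<close> is a subspace, and \<open>\<delta>\<close> at \<open>x0\<close>;
  they are compatible with \<open>N\<close> because \<open>x0\<close> has distance at least \<open>\<delta>\<close> from \<open>R\<close>. The real functional
  \<open>g\<close> obtained is the real part of \<open>x \<mapsto> g x - \<i> g (\<i> x)\<close>, which is complex linear.\<close>

lemma separating_functional:
  assumes V: "csubspace V" and N: "norm_on V N" and R: "csubspace R" and RV: "R \<subseteq> V"
    and x0: "x0 \<in> V" and \<delta>: "\<delta> > 0" and far: "\<And>r. r \<in> R \<Longrightarrow> \<delta> \<le> N (x0 - r)"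
  obtains \<Phi> where "\<Phi> \<in> dual_space V N" "\<And>r. r \<in> R \<Longrightarrow> \<Phi> r = 0" "\<Phi> x0 \<noteq> 0"
proof -
  define C where "C = {(complex_of_real t *\<^sub>C x0 - r, t * \<delta>) |t r. t \<ge> 0 \<and> r \<in> R}"
  have CI: "(complex_of_real t *\<^sub>C x0 - r, t * \<delta>) \<in> C" if "t \<ge> 0" "r \<in> R" for t r
    using that unfolding C_def by blast
  have CE: "\<exists>t\<ge>0. \<exists>r\<in>R. c = complex_of_real t *\<^sub>C x0 - r \<and> s = t * \<delta>" if "(c, s) \<in> C" for c s
    using that unfolding C_def by blast
  have scaleV: "a *\<^sub>C x \<in> V" if "x \<in> V" for a x
    using V that by (rule complex_vector.subspace_scale)
  have "sublinear_on V N"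
    using N by (simp add: sublinear_on_def norm_on_triangle norm_on_scale)
  then obtain g where g_add: "\<And>x y. x \<in> V \<Longrightarrow> y \<in> V \<Longrightarrow> g (x + y) = g x + g y"
    and g_scale: "\<And>t x. x \<in> V \<Longrightarrow> g (complex_of_real t *\<^sub>C x) = t * g x"
    and g_le: "\<And>x. x \<in> V \<Longrightarrow> g x \<le> N x"
    and g_C: "\<And>c s. (c, s) \<in> C \<Longrightarrow> s \<le> g c"
  proof (rule Hahn_Banach_cone[OF V, of N C])
    show "fst ` C \<subseteq> V"
      using V RV x0 scaleV unfolding C_def by (auto intro!: complex_vector.subspace_diff)
    show "(0, 0) \<in> C"
      using CI[of 0 0] complex_vector.subspace_0[OF R] by simp
    show "(c + c', s + s') \<in> C" if "(c, s) \<in> C" "(c', s') \<in> C" for c s c' s'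
    proof -
      obtain t r where t: "t \<ge> 0" "r \<in> R" "c = complex_of_real t *\<^sub>C x0 - r" "s = t * \<delta>"
        using CE[OF \<open>(c, s) \<in> C\<close>] by blast
      obtain t' r' where t': "t' \<ge> 0" "r' \<in> R" "c' = complex_of_real t' *\<^sub>C x0 - r'" "s' = t' * \<delta>"
        using CE[OF \<open>(c', s') \<in> C\<close>] by blast
      have "c + c' = complex_of_real (t + t') *\<^sub>C x0 - (r + r')" "s + s' = (t + t') * \<delta>"
        by (simp_all only: t t' scaleC_add_left distrib_right of_real_add add_diff_add)
      moreover have "r + r' \<in> R" using R t(2) t'(2) by (rule complex_vector.subspace_add)
      ultimately show ?thesis
        using t(1) t'(1) by (simp only:) (intro CI add_nonneg_nonneg)
    qed
    show "(complex_of_real t *\<^sub>C c, t * s) \<in> C" if "t > 0" "(c, s) \<in> C" for t c s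
    proof -
      obtain t' r where t': "t' \<ge> 0" "r \<in> R" "c = complex_of_real t' *\<^sub>C x0 - r" "s = t' * \<delta>"
        using CE[OF \<open>(c, s) \<in> C\<close>] by blast
      have "complex_of_real t *\<^sub>C r \<in> R" using R t'(2) by (rule complex_vector.subspace_scale)
      then show ?thesis
        using \<open>t > 0\<close> CI[of "t * t'" "complex_of_real t *\<^sub>C r"] t'
        by (simp add: scaleC_scaleC complex_vector.scale_right_diff_distrib mult.assoc)
    qed
    show "s \<le> N c" if "(c, s) \<in> C" for c s
    proof -
      obtain t r where t: "t \<ge> 0" "r \<in> R" "c = complex_of_real t *\<^sub>C x0 - r" "s = t * \<delta>"
        using CE[OF \<open>(c, s) \<in> C\<close>] by blast
      have cV: "c \<in> V"
        using t RV x0 scaleV V by (auto intro!: complex_vector.subspace_diff)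
      show ?thesis
      proof (cases "t = 0")
        case True
        then show ?thesis using t norm_on_nonneg[OF N cV] by simp
      next
        case False
        let ?r = "complex_of_real (1/t) *\<^sub>C r"
        have r: "?r \<in> R" using R t by (intro complex_vector.subspace_scale)
        have "c = complex_of_real t *\<^sub>C (x0 - ?r)"
          using False t
          by (simp add: complex_vector.scale_right_diff_distrib scaleC_scaleC scaleC_one
              flip: of_real_mult)
        moreover have "x0 - ?r \<in> V" using V x0 r RV by (auto intro: complex_vector.subspace_diff)
        ultimately have "N c = t * N (x0 - ?r)"
          using t(1) norm_on_scale[OF N] by simp
        then show ?thesis using far[OF r] t by (simp add: mult_left_mono)
      qed
    qed
  qed (rule that)
  have g_uminus: "g (- x) = - g x" if "x \<in> V" for x
    using g_scale[OF that, of "-1"] by (simp add: scaleC_one)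
  have g_abs: "\<bar>g x\<bar> \<le> N x" if "x \<in> V" for x
  proof -
    have "N (- x) = N x"
      using norm_on_scale[OF N that, of "-1"] by (simp add: scaleC_one)
    then show ?thesis
      using g_le[OF that] g_le[of "- x"] g_uminus[OF that] V that
      by (auto simp: complex_vector.subspace_neg abs_le_iff)
  qed
  have g_R: "g r = 0" if "r \<in> R" for r
  proof -
    have "(- r, 0) \<in> C" "(r, 0) \<in> C"
      using CI[of 0 r] CI[of 0 "- r"] that complex_vector.subspace_neg[OF R that] by simp_all
    then have "0 \<le> g (- r)" "0 \<le> g r" by (auto intro: g_C)
    moreover have "r \<in> V" using RV that by blast
    ultimately show ?thesis using g_uminus[of r] by simp
  qed
  define \<Phi> where "\<Phi> x = (if x \<in> V then Complex (g x) (- g (\<i> *\<^sub>C x)) else 0)" for x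
  have \<Phi>_add: "\<Phi> (x + y) = \<Phi> x + \<Phi> y" if "x \<in> V" "y \<in> V" for x y
    using that V scaleV by (simp add: \<Phi>_def complex_eq_iff g_add scaleC_add_right
        complex_vector.subspace_add)
  have \<Phi>_scale: "\<Phi> (a *\<^sub>C x) = a *\<^sub>C \<Phi> x" if x: "x \<in> V" for a x
  proof -
    have split: "b *\<^sub>C x = complex_of_real (Re b) *\<^sub>C x + complex_of_real (Im b) *\<^sub>C \<i> *\<^sub>C x" for b
      by (subst complex_eq[of b]) (simp add: scaleC_add_left scaleC_scaleC mult.commute)
    have g_complex: "g (b *\<^sub>C x) = Re b * g x + Im b * g (\<i> *\<^sub>C x)" for b
      by (subst split) (simp only: g_add g_scale scaleV x)
    show ?thesis
      using x scaleV g_complex[of a] g_complex[of "\<i> * a"]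
      by (simp add: \<Phi>_def scaleC_complex_def complex_eq_iff scaleC_scaleC)
  qed
  have "cmod (\<Phi> x) \<le> 2 * N x" if x: "x \<in> V" for x
  proof -
    have "cmod (\<Phi> x) \<le> \<bar>g x\<bar> + \<bar>g (\<i> *\<^sub>C x)\<bar>"
      using x cmod_le[of "\<Phi> x"] by (simp add: \<Phi>_def)
    also have "\<dots> \<le> N x + N (\<i> *\<^sub>C x)"
      using x scaleV by (intro add_mono g_abs)
    finally show ?thesis using norm_on_scale[OF N x, of \<i>] by simp
  qed
  then have "\<Phi> \<in> dual_space V N"
    using \<Phi>_add \<Phi>_scale unfolding dual_space_def clinear_on_def bounded_on_def
    by (auto simp: \<Phi>_def)
  moreover have "\<Phi> r = 0" if "r \<in> R" for r
    using that g_R complex_vector.subspace_scale[OF R that, of \<i>] RV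
    by (auto simp: \<Phi>_def complex_eq_iff)
  moreover have "(x0, \<delta>) \<in> C"
    using CI[of 1 0] complex_vector.subspace_0[OF R] by (simp add: scaleC_one)
  then have "\<delta> \<le> g x0" by (rule g_C)
  then have "\<Phi> x0 \<noteq> 0" using x0 \<delta> by (simp add: \<Phi>_def complex_eq_iff)
  ultimately show ?thesis by (rule that)
qed


section \<open>Forms on a reflexive space that are bounded below\<close>

lemma dual_norm_le:
  assumes V: "csubspace V" and N: "norm_on V N" and C: "0 \<le> C"
    and le: "\<And>x. x \<in> V \<Longrightarrow> cmod (f x) \<le> C * N x"
  shows "dual_norm V N f \<le> C"
  unfolding dual_norm_def
proof (rule cSUP_least)
  have "0 \<in> V" using V by (rule complex_vector.subspace_0)
  moreover then have "N 0 = 0" using norm_on_eq_0[OF N] by simp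
  ultimately show "{x \<in> V. N x \<le> 1} \<noteq> {}" by force
next
  fix x assume "x \<in> {x \<in> V. N x \<le> 1}"
  then show "cmod (f x) \<le> C"
    using le[of x] C mult_left_le[of "N x" C] by simp
qed

lemma dual_norm_upper:
  assumes N: "norm_on V N" and f: "f \<in> dual_space V N" and x: "x \<in> V" "N x \<le> 1"
  shows "cmod (f x) \<le> dual_norm V N f"
proof -
  obtain C where C: "\<And>y. y \<in> V \<Longrightarrow> cmod (f y) \<le> C * N y"
    using f by (auto simp: dual_space_def bounded_on_def)
  have bdd: "bdd_above ((\<lambda>x. cmod (f x)) ` {x \<in> V. N x \<le> 1})"
  proof (rule bdd_aboveI2)
    fix y assume y: "y \<in> {x \<in> V. N x \<le> 1}"
    then have "cmod (f y) \<le> \<bar>C\<bar> * N y"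
      using C[of y] norm_on_nonneg[OF N, of y] by (smt (verit) mem_Collect_eq mult_right_mono)
    then show "cmod (f y) \<le> \<bar>C\<bar>"
      using y mult_left_le[of "N y" "\<bar>C\<bar>"] by simp
  qed
  then show ?thesis
    unfolding dual_norm_def using x by (intro cSUP_upper) auto
qed

lemma cmod_le_dual_norm:
  assumes V: "csubspace V" and N: "norm_on V N" and f: "f \<in> dual_space V N" and x: "x \<in> V"
  shows "cmod (f x) \<le> dual_norm V N f * N x"
proof (cases "x = 0")
  case True
  have "f 0 = 0"
    using f complex_vector.subspace_0[OF V] unfolding dual_space_def clinear_on_def
    by (metis (mono_tags, lifting) add_cancel_right_right mem_Collect_eq)
  then show ?thesis using True norm_on_eq_0[OF N x] by simp
next
  case False
  then have pos: "N x > 0"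
    using norm_on_nonneg[OF N x] norm_on_eq_0[OF N x] by simp
  let ?y = "complex_of_real (1 / N x) *\<^sub>C x"
  have y: "?y \<in> V" using V x by (rule complex_vector.subspace_scale)
  moreover have "N ?y = 1" using norm_on_scale[OF N x] pos by (simp add: norm_divide)
  ultimately have "cmod (f ?y) \<le> dual_norm V N f"
    by (intro dual_norm_upper[OF N f]) simp_all
  moreover have "f ?y = complex_of_real (1 / N x) * f x"
    using f x by (simp only: dual_space_def clinear_on_def scaleC_complex_def mem_Collect_eq)
  then have "cmod (f ?y) = cmod (f x) / N x"
    using pos by (simp only: norm_mult norm_of_real) simp
  ultimately show ?thesis
    using pos by (simp only: pos_divide_le_eq)
qed

lemma csubspace_dual_space:
  assumes N: "norm_on V N"
  shows "csubspace (dual_space V N)"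
proof (rule complex_vector.subspaceI)
  show "0 \<in> dual_space V N"
    by (auto simp: dual_space_def clinear_on_def bounded_on_def scaleC_complex_def
        intro!: exI[of _ 0])
next
  fix f g assume fg: "f \<in> dual_space V N" "g \<in> dual_space V N"
  then obtain C D where "\<And>x. x \<in> V \<Longrightarrow> cmod (f x) \<le> C * N x" "\<And>x. x \<in> V \<Longrightarrow> cmod (g x) \<le> D * N x"
    unfolding dual_space_def bounded_on_def by blast
  then have "cmod ((f + g) x) \<le> (C + D) * N x" if "x \<in> V" for x
    using that norm_triangle_mono[of "f x" _ "g x"] by (simp add: distrib_right)
  then have "bounded_on V N (f + g)" unfolding bounded_on_def by blast
  then show "f + g \<in> dual_space V N"
    using fg by (simp add: dual_space_def clinear_on_def scaleC_add_right)
next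
  fix a f assume f: "f \<in> dual_space V N"
  then obtain C where "\<And>x. x \<in> V \<Longrightarrow> cmod (f x) \<le> C * N x"
    by (auto simp: dual_space_def bounded_on_def)
  then have "cmod ((a *\<^sub>C f) x) \<le> (cmod a * C) * N x" if "x \<in> V" for x
    using that by (simp add: scaleC_fun_def scaleC_complex_def norm_mult mult.assoc mult_left_mono)
  then have "bounded_on V N (a *\<^sub>C f)" unfolding bounded_on_def by blast
  then show "a *\<^sub>C f \<in> dual_space V N"
    using f by (simp add: dual_space_def clinear_on_def scaleC_fun_def scaleC_complex_def
        distrib_left mult.left_commute)
qed

lemma norm_on_dual_norm:
  assumes V: "csubspace V" and N: "norm_on V N"
  shows "norm_on (dual_space V N) (dual_norm V N)"
proof -
  let ?F = "dual_space V N" and ?n = "dual_norm V N"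
  note le = cmod_le_dual_norm[OF V N]
  have nonneg: "0 \<le> ?n f" if "f \<in> ?F" for f
  proof -
    have "0 \<in> V" using V by (rule complex_vector.subspace_0)
    moreover have "N 0 = 0" using norm_on_eq_0[OF N \<open>0 \<in> V\<close>] by simp
    ultimately have "cmod (f 0) \<le> ?n f"
      by (intro dual_norm_upper[OF N that]) simp_all
    then show ?thesis using norm_ge_zero order_trans by blast
  qed
  have scale_le: "?n (a *\<^sub>C f) \<le> cmod a * ?n f" if f: "f \<in> ?F" for a f
    using nonneg[OF f] le[OF f]
    by (intro dual_norm_le[OF V N])
      (auto simp: scaleC_fun_def scaleC_complex_def norm_mult mult.assoc mult_left_mono)
  have scaleF: "a *\<^sub>C f \<in> ?F" if "f \<in> ?F" for a f
    using csubspace_dual_space[OF N] that by (rule complex_vector.subspace_scale)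
  have zero: "?n 0 = 0"
  proof -
    have "0 \<in> ?F" using csubspace_dual_space[OF N] by (rule complex_vector.subspace_0)
    then show ?thesis using nonneg[of 0] dual_norm_le[OF V N, of 0 0] by simp
  qed
  show ?thesis
    unfolding norm_on_def
  proof (intro conjI ballI allI)
    fix f assume f: "f \<in> ?F"
    show "0 \<le> ?n f" using f by (rule nonneg)
    show "?n f = 0 \<longleftrightarrow> f = 0"
    proof
      assume "?n f = 0"
      then have "f x = 0" for x
        using le[OF f, of x] f by (cases "x \<in> V") (auto simp: dual_space_def)
      then show "f = 0" by (simp add: fun_eq_iff)
    qed (use zero in simp)
    show "?n (f + g) \<le> ?n f + ?n g" if g: "g \<in> ?F" for g
    proof (rule dual_norm_le[OF V N])
      show "0 \<le> ?n f + ?n g" using nonneg f g by simp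
      show "cmod ((f + g) x) \<le> (?n f + ?n g) * N x" if "x \<in> V" for x
        using norm_triangle_mono[OF le[OF f that] le[OF g that]] by (simp add: distrib_right)
    qed
    show "?n (a *\<^sub>C f) = cmod a * ?n f" for a
    proof (cases "a = 0")
      case True
      then show ?thesis using zero by simp
    next
      case False
      have "?n (inverse a *\<^sub>C a *\<^sub>C f) \<le> cmod (inverse a) * ?n (a *\<^sub>C f)"
        using f by (intro scale_le scaleF)
      moreover have "inverse a *\<^sub>C a *\<^sub>C f = f" using False by (simp add: scaleC_scaleC scaleC_one)
      ultimately have "cmod a * ?n f \<le> ?n (a *\<^sub>C f)"
        using False by (simp only: norm_inverse) (simp add: field_simps)
      then show ?thesis using scale_le[OF f, of a] by simp
    qed
  qed
qed
text \<open>Antilinear functionals are conjugated to elements of the dual space, where reflexivity is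
  stated: \<open>l\<close> corresponds to \<open>\<Lambda>\<close> and \<open>A \<xi>\<close> to \<open>\<Psi>(\<xi>,\<cdot>)\<close>. If \<open>l\<close> has positive distance from the range of
  \<open>A\<close>, a functional on the dual separates them; by reflexivity it is evaluation at a vector that
  nondegeneracy forces to vanish. Otherwise \<open>l\<close> is a limit of \<open>A (X n)\<close>, the lower bound makes
  \<open>X\<close> a Cauchy sequence, and its limit is the solution.\<close>

theorem reflexive_form_surjective:
  assumes V: "csubspace V" and N: "norm_on V N" and complete: "complete_on V N"
    and reflexive: "reflexive_on V N" and \<Psi>: "sesquilinear_on V \<Psi>"
    and bounded: "\<And>\<xi> \<eta>. \<xi> \<in> V \<Longrightarrow> \<eta> \<in> V \<Longrightarrow> cmod (\<Psi> \<xi> \<eta>) \<le> \<beta> * N \<xi> * N \<eta>"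
    and c: "c > 0"
    and below: "\<And>\<xi> K. \<xi> \<in> V \<Longrightarrow> 0 \<le> K \<Longrightarrow> (\<And>\<eta>. \<eta> \<in> V \<Longrightarrow> cmod (\<Psi> \<xi> \<eta>) \<le> K * N \<eta>) \<Longrightarrow>
      c * N \<xi> \<le> K"
    and nondegenerate: "\<And>\<eta>. \<eta> \<in> V \<Longrightarrow> (\<And>\<xi>. \<xi> \<in> V \<Longrightarrow> \<Psi> \<xi> \<eta> = 0) \<Longrightarrow> \<eta> = 0"
    and \<Lambda>: "\<Lambda> \<in> conj_dual_space V N"
  shows "\<exists>\<xi>\<in>V. \<forall>\<eta>\<in>V. \<Lambda> \<eta> = \<Psi> \<xi> \<eta>"
proof -
  let ?F = "dual_space V N" and ?n = "dual_norm V N"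
  define A where "A \<xi> = (\<lambda>\<eta>. if \<eta> \<in> V then cnj (\<Psi> \<xi> \<eta>) else 0)" for \<xi>
  define l where "l = (\<lambda>\<eta>. cnj (\<Lambda> \<eta>))"
  have \<Psi>_left: "\<Psi> (\<xi> + \<xi>') \<eta> = \<Psi> \<xi> \<eta> + \<Psi> \<xi>' \<eta>" "\<Psi> (a *\<^sub>C \<xi>) \<eta> = a * \<Psi> \<xi> \<eta>"
    if "\<xi> \<in> V" "\<xi>' \<in> V" "\<eta> \<in> V" for \<xi> \<xi>' \<eta> a
    using \<Psi> that by (simp_all add: sesquilinear_on_def clinear_on_def scaleC_complex_def)
  have \<Psi>_diff: "\<Psi> (\<xi> - \<xi>') \<eta> = \<Psi> \<xi> \<eta> - \<Psi> \<xi>' \<eta>" if "\<xi> \<in> V" "\<xi>' \<in> V" "\<eta> \<in> V" for \<xi> \<xi>' \<eta>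
    using \<Psi>_left(1)[of "\<xi> - \<xi>'" \<xi>' \<eta>] that complex_vector.subspace_diff[OF V] by simp
  have AF: "A \<xi> \<in> ?F" if "\<xi> \<in> V" for \<xi>
  proof -
    have "bounded_on V N (A \<xi>)"
      using bounded[OF that] unfolding bounded_on_def A_def by (intro exI[of _ "\<beta> * N \<xi>"]) simp
    moreover have "clinear_on V (A \<xi>)"
      using \<Psi> that V by (simp add: A_def clinear_on_def sesquilinear_on_def conj_linear_on_def
          scaleC_complex_def complex_vector.subspace_add complex_vector.subspace_scale)
    ultimately show ?thesis by (simp add: dual_space_def A_def)
  qed
  have lF: "l \<in> ?F"
    using \<Lambda> by (simp add: dual_space_def conj_dual_space_def l_def clinear_on_def
        conj_linear_on_def bounded_on_def scaleC_complex_def)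
  have F: "csubspace ?F" using N by (rule csubspace_dual_space)
  have R: "csubspace (A ` V)"
  proof (rule complex_vector.subspaceI)
    have "A 0 = 0"
      using \<Psi>_diff[of 0 0] complex_vector.subspace_0[OF V] by (simp add: A_def fun_eq_iff)
    then show "0 \<in> A ` V" using complex_vector.subspace_0[OF V] by force
  next
    fix f g assume "f \<in> A ` V" "g \<in> A ` V"
    then obtain \<xi> \<xi>' where \<xi>: "\<xi> \<in> V" "\<xi>' \<in> V" "f = A \<xi>" "g = A \<xi>'" by blast
    then have "f + g = A (\<xi> + \<xi>')" by (simp add: A_def fun_eq_iff \<Psi>_left)
    then show "f + g \<in> A ` V" using complex_vector.subspace_add[OF V \<xi>(1,2)] by blast
  next
    fix a f assume "f \<in> A ` V"
    then obtain \<xi> where \<xi>: "\<xi> \<in> V" "f = A \<xi>" by blast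
    then have "a *\<^sub>C f = A (cnj a *\<^sub>C \<xi>)"
      by (simp add: A_def fun_eq_iff \<Psi>_left scaleC_fun_def scaleC_complex_def)
    then show "a *\<^sub>C f \<in> A ` V" using complex_vector.subspace_scale[OF V \<xi>(1)] by blast
  qed
  show ?thesis
  proof (cases "\<exists>\<delta>>0. \<forall>\<xi>\<in>V. \<delta> \<le> ?n (l - A \<xi>)")
    case True
    then obtain \<delta> where \<delta>: "\<delta> > 0" "\<And>\<xi>. \<xi> \<in> V \<Longrightarrow> \<delta> \<le> ?n (l - A \<xi>)" by blast
    obtain \<Phi> where \<Phi>: "\<Phi> \<in> dual_space ?F ?n" "\<And>f. f \<in> A ` V \<Longrightarrow> \<Phi> f = 0" "\<Phi> l \<noteq> 0"
      using separating_functional[OF F norm_on_dual_norm[OF V N] R _ lF \<delta>(1)] \<delta>(2) AF by blast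
    obtain \<eta> where \<eta>: "\<eta> \<in> V" "\<And>f. f \<in> ?F \<Longrightarrow> \<Phi> f = f \<eta>"
      using reflexive \<Phi>(1) unfolding reflexive_on_def by blast
    have "\<Psi> \<xi> \<eta> = 0" if "\<xi> \<in> V" for \<xi>
      using \<Phi>(2)[of "A \<xi>"] \<eta>(2)[OF AF[OF that]] that \<eta>(1) by (simp add: A_def)
    then have "\<eta> = 0" by (rule nondegenerate[OF \<eta>(1)])
    then have "l \<eta> = 0"
      using cmod_le_dual_norm[OF V N lF \<eta>(1)] norm_on_eq_0[OF N \<eta>(1)] by simp
    then show ?thesis using \<Phi>(3) \<eta>(2)[OF lF] by simp
  next
    case False
    have "\<exists>\<xi>\<in>V. ?n (l - A \<xi>) < inverse (real (Suc n))" for n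
    proof -
      have "inverse (real (Suc n)) > 0" by simp
      then show ?thesis using False by (meson not_le)
    qed
    then obtain X where X: "\<And>n. X n \<in> V" "\<And>n. ?n (l - A (X n)) < inverse (real (Suc n))"
      by metis
    have approx: "cmod (\<Lambda> \<eta> - \<Psi> (X n) \<eta>) \<le> inverse (real (Suc n)) * N \<eta>" if \<eta>: "\<eta> \<in> V" for n \<eta>
    proof -
      have "l - A (X n) \<in> ?F" using F lF AF[OF X(1)] by (rule complex_vector.subspace_diff)
      then have "cmod ((l - A (X n)) \<eta>) \<le> ?n (l - A (X n)) * N \<eta>"
        using \<eta> by (rule cmod_le_dual_norm[OF V N])
      also have "\<dots> \<le> inverse (real (Suc n)) * N \<eta>"
        using X(2)[of n] norm_on_nonneg[OF N \<eta>] by (intro mult_right_mono) auto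
      also have "(l - A (X n)) \<eta> = cnj (\<Lambda> \<eta> - \<Psi> (X n) \<eta>)"
        using \<eta> by (simp add: l_def A_def)
      finally show ?thesis by (simp only: complex_mod_cnj)
    qed
    have cauchy: "c * N (X m - X n) \<le> inverse (real (Suc m)) + inverse (real (Suc n))" for m n
    proof (rule below)
      show "X m - X n \<in> V" using V X by (intro complex_vector.subspace_diff)
      show "0 \<le> inverse (real (Suc m)) + inverse (real (Suc n))" by simp
      fix \<eta> assume \<eta>: "\<eta> \<in> V"
      have "\<Psi> (X m - X n) \<eta> = (\<Lambda> \<eta> - \<Psi> (X n) \<eta>) - (\<Lambda> \<eta> - \<Psi> (X m) \<eta>)"
        using \<Psi>_diff[OF X(1) X(1) \<eta>] by simp
      then have "cmod (\<Psi> (X m - X n) \<eta>) \<le> cmod (\<Lambda> \<eta> - \<Psi> (X n) \<eta>) + cmod (\<Lambda> \<eta> - \<Psi> (X m) \<eta>)"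
        using norm_triangle_ineq4 by metis
      then show "cmod (\<Psi> (X m - X n) \<eta>) \<le> (inverse (real (Suc m)) + inverse (real (Suc n))) * N \<eta>"
        using approx[OF \<eta>, of m] approx[OF \<eta>, of n] by (simp only: distrib_right)
    qed
    have "\<exists>M. \<forall>m\<ge>M. \<forall>n\<ge>M. N (X m - X n) < e" if "e > 0" for e :: real
    proof -
      have "c * e / 2 > 0" using c that by simp
      then obtain M where M: "inverse (real (Suc M)) < c * e / 2" using reals_Archimedean by blast
      have "N (X m - X n) < e" if "m \<ge> M" "n \<ge> M" for m n
      proof -
        have "inverse (real (Suc m)) \<le> inverse (real (Suc M))"
          "inverse (real (Suc n)) \<le> inverse (real (Suc M))"
          using that by (simp_all add: le_imp_inverse_le)
        then have "c * N (X m - X n) < c * e" using cauchy[of m n] M by linarith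
        then show ?thesis using c by simp
      qed
      then show ?thesis by blast
    qed
    then obtain \<xi> where \<xi>: "\<xi> \<in> V" "(\<lambda>n. N (X n - \<xi>)) \<longlonglongrightarrow> 0"
      using complete X(1) unfolding complete_on_def by blast
    have "\<Lambda> \<eta> = \<Psi> \<xi> \<eta>" if \<eta>: "\<eta> \<in> V" for \<eta>
    proof -
      have "cmod (\<Lambda> \<eta> - \<Psi> \<xi> \<eta>) \<le> inverse (real (Suc n)) * N \<eta> + \<beta> * N (X n - \<xi>) * N \<eta>" for n
      proof -
        have "\<Lambda> \<eta> - \<Psi> \<xi> \<eta> = (\<Lambda> \<eta> - \<Psi> (X n) \<eta>) + \<Psi> (X n - \<xi>) \<eta>"
          using \<Psi>_diff[OF X(1) \<xi>(1) \<eta>] by simp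
        moreover have "X n - \<xi> \<in> V" using V X(1) \<xi>(1) by (rule complex_vector.subspace_diff)
        ultimately show ?thesis
          using norm_triangle_mono[OF approx[OF \<eta>] bounded[OF _ \<eta>]] by metis
      qed
      moreover have "(\<lambda>n. inverse (real (Suc n)) * N \<eta> + \<beta> * N (X n - \<xi>) * N \<eta>)
          \<longlonglongrightarrow> 0 * N \<eta> + \<beta> * 0 * N \<eta>"
        by (intro tendsto_intros LIMSEQ_inverse_real_of_nat \<xi>(2))
      ultimately have "cmod (\<Lambda> \<eta> - \<Psi> \<xi> \<eta>) \<le> 0 * N \<eta> + \<beta> * 0 * N \<eta>"
        by (intro LIMSEQ_le_const) auto
      then show ?thesis by simp
    qed
    then show ?thesis using \<xi>(1) by blast
  qed
qed


section \<open>The inner product\<close>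

lemma norm_scaleC:
  fixes x :: "'h::chilbert_space"
  shows "norm (a *\<^sub>C x) = cmod a * norm x"
proof -
  have "cinner x (a *\<^sub>C x) = cnj a * cinner x x"
    using cinner_commute[of x "a *\<^sub>C x"] cinner_commute[of x x]
    by (simp only: cinner_scaleC_left complex_cnj_mult complex_cnj_cnj)
  then have "cinner (a *\<^sub>C x) (a *\<^sub>C x) = (a * cnj a) * cinner x x"
    by (simp only: cinner_scaleC_left mult.assoc)
  then have "complex_of_real ((norm (a *\<^sub>C x))\<^sup>2) = complex_of_real ((cmod a * norm x)\<^sup>2)"
    by (simp only: cinner_self complex_norm_square[symmetric] of_real_mult power_mult_distrib)
  then have "(norm (a *\<^sub>C x))\<^sup>2 = (cmod a * norm x)\<^sup>2"
    by (simp only: of_real_eq_iff)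
  then show ?thesis by (simp add: power2_eq_iff_nonneg)
qed

lemma cinner_add_right: "cinner x (y + z) = cinner x y + cinner (x::'h::chilbert_space) z"
  by (metis cinner_add_left cinner_commute complex_cnj_add)

lemma cinner_scaleC_right: "cinner x (a *\<^sub>C y) = cnj a * cinner (x::'h::chilbert_space) y"
  by (metis cinner_scaleC_left cinner_commute complex_cnj_mult)

lemma cinner_diff_left: "cinner (x - y) z = cinner x z - cinner (y::'h::chilbert_space) z"
  using cinner_add_left[of "x - y" y z] by simp

lemma cinner_diff_right: "cinner z (x - y) = cinner z x - cinner (z::'h::chilbert_space) y"
  using cinner_add_right[of z "x - y" y] by simp

text \<open>The Cauchy--Schwarz inequality is the triangle inequality of the given norm, squared, after
  \<open>x\<close> has been multiplied by a phase \<open>s\<close> that makes the inner product real and nonnegative.\<close>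

lemma cmod_cinner_le: "cmod (cinner x y) \<le> norm x * norm (y::'h::chilbert_space)"
proof -
  have Re_le: "Re (cinner u y) \<le> norm u * norm y" for u
  proof -
    have "cinner (u + y) (u + y) = cinner u u + cinner y y + (cinner u y + cnj (cinner u y))"
      using cinner_commute[of y u] by (simp add: cinner_add_left cinner_add_right)
    then have "(norm (u + y))\<^sup>2 = (norm u)\<^sup>2 + (norm y)\<^sup>2 + 2 * Re (cinner u y)"
      by (simp add: cinner_self complex_eq_iff)
    moreover have "(norm (u + y))\<^sup>2 \<le> (norm u + norm y)\<^sup>2"
      by (intro power_mono norm_triangle_ineq) simp
    ultimately show ?thesis by (simp add: power2_sum)
  qed
  define w where "w = cinner x y"
  define s where "s = cnj w / complex_of_real (cmod w)"
  have "s * w = w * cnj w / complex_of_real (cmod w)"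
    by (simp add: s_def mult.commute)
  also have "\<dots> = complex_of_real ((cmod w)\<^sup>2 / cmod w)"
    by (simp only: complex_norm_square of_real_divide)
  finally have "s * w = complex_of_real (cmod w)"
    by (simp add: power2_eq_square)
  then have "cmod w = Re (cinner (s *\<^sub>C x) y)"
    by (simp add: cinner_scaleC_left flip: w_def)
  also have "\<dots> \<le> norm (s *\<^sub>C x) * norm y" by (rule Re_le)
  also have "\<dots> \<le> 1 * norm x * norm y"
    unfolding norm_scaleC by (intro mult_right_mono) (auto simp: s_def norm_divide divide_le_eq_1)
  finally show ?thesis by (simp add: w_def)
qed

lemma cinner_eq_on_dense:
  fixes \<zeta> \<zeta>' :: "'h::chilbert_space"
  assumes dense: "closure D = UNIV" and eq: "\<And>\<eta>. \<eta> \<in> D \<Longrightarrow> cinner \<zeta> \<eta> = cinner \<zeta>' \<eta>"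
  shows "\<zeta> = \<zeta>'"
proof -
  define z where "z = \<zeta> - \<zeta>'"
  have "z \<in> closure D" using dense by simp
  then obtain Y where Y: "\<And>n. Y n \<in> D" "Y \<longlonglongrightarrow> z"
    unfolding closure_sequential by blast
  have "(norm z)\<^sup>2 \<le> norm z * norm (z - Y n)" for n
  proof -
    have "cinner z (Y n) = 0"
      using eq[OF Y(1)] by (simp add: z_def cinner_diff_left)
    then have "cinner z (z - Y n) = complex_of_real ((norm z)\<^sup>2)"
      by (simp add: cinner_diff_right cinner_self)
    then show ?thesis
      using cmod_cinner_le[of z "z - Y n"] by (simp only: norm_of_real abs_power2)
  qed
  moreover have "(\<lambda>n. norm z * norm (z - Y n)) \<longlonglongrightarrow> norm z * norm (z - z)"
    by (intro tendsto_intros Y(2))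
  ultimately have "(norm z)\<^sup>2 \<le> norm z * norm (z - z)"
    by (intro LIMSEQ_le_const) auto
  then show ?thesis by (simp add: z_def)
qed

lemma bounded_sesquilinear_cinner:
  "bounded_sesquilinear (\<lambda>\<xi> \<eta>. a * cinner \<xi> (\<eta>::'h::chilbert_space))"
  unfolding bounded_sesquilinear_def
proof (intro conjI exI allI)
  show "sesquilinear_on UNIV (\<lambda>\<xi> \<eta>::'h. a * cinner \<xi> \<eta>)"
    by (simp add: sesquilinear_on_def clinear_on_def conj_linear_on_def scaleC_complex_def
        cinner_add_left cinner_add_right cinner_scaleC_left cinner_scaleC_right
        distrib_left mult.left_commute)
  show "cmod (a * cinner \<xi> \<eta>) \<le> cmod a * norm \<xi> * norm \<eta>" for \<xi> \<eta> :: 'h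
    using mult_left_mono[OF cmod_cinner_le norm_ge_zero] by (simp add: norm_mult mult.assoc)
qed


section \<open>The associated operator\<close>

lemma associated_operator_eq_Some_iff:
  assumes "closure \<D> = UNIV"
  shows "associated_operator \<D> \<Omega> \<xi> = Some \<zeta> \<longleftrightarrow> \<xi> \<in> \<D> \<and> (\<forall>\<eta>\<in>\<D>. \<Omega> \<xi> \<eta> = cinner \<zeta> \<eta>)"
proof -
  have uniq: "\<zeta>1 = \<zeta>2" if "\<forall>\<eta>\<in>\<D>. \<Omega> \<xi> \<eta> = cinner \<zeta>1 \<eta>" "\<forall>\<eta>\<in>\<D>. \<Omega> \<xi> \<eta> = cinner \<zeta>2 \<eta>" for \<zeta>1 \<zeta>2
    using that by (intro cinner_eq_on_dense[OF assms]) simp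
  have the: "(THE \<zeta>. \<forall>\<eta>\<in>\<D>. \<Omega> \<xi> \<eta> = cinner \<zeta> \<eta>) = \<zeta>'" if "\<forall>\<eta>\<in>\<D>. \<Omega> \<xi> \<eta> = cinner \<zeta>' \<eta>" for \<zeta>'
    using that by (rule the_equality) (rule uniq[OF _ that])
  show ?thesis
  proof (cases "\<xi> \<in> \<D> \<and> (\<exists>\<zeta>. \<forall>\<eta>\<in>\<D>. \<Omega> \<xi> \<eta> = cinner \<zeta> \<eta>)")
    case True
    then obtain \<zeta>' where \<zeta>': "\<forall>\<eta>\<in>\<D>. \<Omega> \<xi> \<eta> = cinner \<zeta>' \<eta>" by blast
    then have some: "associated_operator \<D> \<Omega> \<xi> = Some \<zeta>'"
      using True the by (simp add: associated_operator_def)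
    show ?thesis
    proof
      assume "associated_operator \<D> \<Omega> \<xi> = Some \<zeta>"
      then have "\<zeta> = \<zeta>'" using some by simp
      then show "\<xi> \<in> \<D> \<and> (\<forall>\<eta>\<in>\<D>. \<Omega> \<xi> \<eta> = cinner \<zeta> \<eta>)" using \<zeta>' True by simp
    next
      assume "\<xi> \<in> \<D> \<and> (\<forall>\<eta>\<in>\<D>. \<Omega> \<xi> \<eta> = cinner \<zeta> \<eta>)"
      then have "\<zeta>' = \<zeta>" by (intro uniq[OF \<zeta>']) (rule conjunct2)
      then show "associated_operator \<D> \<Omega> \<xi> = Some \<zeta>" using some by simp
    qed
  next
    case False
    then have "associated_operator \<D> \<Omega> \<xi> = None" by (simp only: associated_operator_def if_False)
    then show ?thesis using False by auto
  qed
qed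

lemma linear_operatorI:
  assumes zero: "T 0 = Some 0"
    and add: "\<And>\<xi> \<xi>' \<zeta> \<zeta>'. T \<xi> = Some \<zeta> \<Longrightarrow> T \<xi>' = Some \<zeta>' \<Longrightarrow> T (\<xi> + \<xi>') = Some (\<zeta> + \<zeta>')"
    and scale: "\<And>a \<xi> \<zeta>. T \<xi> = Some \<zeta> \<Longrightarrow> T (a *\<^sub>C \<xi>) = Some (a *\<^sub>C \<zeta>)"
  shows "linear_operator T"
  unfolding linear_operator_def
proof
  show "csubspace (dom T)"
    by (rule complex_vector.subspaceI) (use zero add scale in blast)+
  show "clinear_on (dom T) (\<lambda>\<xi>. the (T \<xi>))"
    unfolding clinear_on_def by (auto simp: add scale)
qed

lemma linear_operator_associated_operator:
  fixes \<D> :: "'h::chilbert_space set"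
  assumes V: "csubspace \<D>" and dense: "closure \<D> = UNIV" and \<Omega>: "sesquilinear_on \<D> \<Omega>"
  shows "linear_operator (associated_operator \<D> \<Omega>)"
proof (rule linear_operatorI)
  note iff = associated_operator_eq_Some_iff[OF dense, of \<Omega>]
  have add: "\<Omega> (\<xi> + \<xi>') \<eta> = \<Omega> \<xi> \<eta> + \<Omega> \<xi>' \<eta>" if "\<xi> \<in> \<D>" "\<xi>' \<in> \<D>" "\<eta> \<in> \<D>" for \<xi> \<xi>' \<eta>
    using \<Omega> that by (simp add: sesquilinear_on_def clinear_on_def)
  have scale: "\<Omega> (a *\<^sub>C \<xi>) \<eta> = a * \<Omega> \<xi> \<eta>" if "\<xi> \<in> \<D>" "\<eta> \<in> \<D>" for a \<xi> \<eta>
    using \<Omega> that by (simp add: sesquilinear_on_def clinear_on_def scaleC_complex_def)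
  show "associated_operator \<D> \<Omega> 0 = Some 0"
    using complex_vector.subspace_0[OF V] add[of 0 0] cinner_diff_left[of "0::'h" 0] by (simp add: iff)
  show "associated_operator \<D> \<Omega> (\<xi> + \<xi>') = Some (\<zeta> + \<zeta>')"
    if "associated_operator \<D> \<Omega> \<xi> = Some \<zeta>" "associated_operator \<D> \<Omega> \<xi>' = Some \<zeta>'" for \<xi> \<xi>' \<zeta> \<zeta>'
    using that complex_vector.subspace_add[OF V] by (simp add: iff add cinner_add_left)
  show "associated_operator \<D> \<Omega> (a *\<^sub>C \<xi>) = Some (a *\<^sub>C \<zeta>)"
    if "associated_operator \<D> \<Omega> \<xi> = Some \<zeta>" for a \<xi> \<zeta>
    using that complex_vector.subspace_scale[OF V] by (simp add: iff scale cinner_scaleC_left)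
qed

lemma operator_numerical_range_associated_operator:
  assumes "closure \<D> = UNIV"
  shows "operator_numerical_range (associated_operator \<D> \<Omega>) \<subseteq> form_numerical_range \<D> \<Omega>"
proof
  fix z assume "z \<in> operator_numerical_range (associated_operator \<D> \<Omega>)"
  then obtain \<xi> \<zeta> where \<xi>: "associated_operator \<D> \<Omega> \<xi> = Some \<zeta>" "norm \<xi> = 1" "z = cinner \<zeta> \<xi>"
    unfolding operator_numerical_range_def by auto
  then have "\<xi> \<in> \<D>" "\<Omega> \<xi> \<xi> = cinner \<zeta> \<xi>"
    by (auto simp: associated_operator_eq_Some_iff[OF assms])
  then show "z \<in> form_numerical_range \<D> \<Omega>"
    using \<xi>(2,3) unfolding form_numerical_range_def by (auto intro!: exI[of _ \<xi>])
qed

text \<open>If \<open>T'\<close> extends \<open>T\<close> and \<open>\<xi>\<close> is in its domain, choose \<open>\<xi>0\<close> in the domain of \<open>T\<close> with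
  \<open>(T - l) \<xi>0 = (T' - l) \<xi>\<close>. A nonzero difference \<open>\<xi> - \<xi>0\<close> would be an eigenvector of \<open>T'\<close> with
  eigenvalue \<open>l\<close>, and eigenvalues belong to the numerical range.\<close>

lemma maximal_operatorI:
  assumes T: "linear_operator T" and range: "operator_numerical_range T \<subseteq> \<nn>"
    and l: "l \<notin> \<nn>" and onto: "\<And>\<kappa>. \<exists>\<xi> \<zeta>. T \<xi> = Some \<zeta> \<and> \<zeta> - l *\<^sub>C \<xi> = \<kappa>"
  shows "maximal_operator \<nn> T"
  unfolding maximal_operator_def
proof (intro conjI allI impI T range)
  fix T' assume T': "linear_operator T'" and ext: "T \<subseteq>\<^sub>m T'"
    and range': "operator_numerical_range T' \<subseteq> \<nn>"
  have dom': "csubspace (dom T')" using T' by (simp add: linear_operator_def)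
  have "\<xi> \<in> dom T" if \<xi>: "\<xi> \<in> dom T'" for \<xi>
  proof -
    obtain \<zeta> where \<zeta>: "T' \<xi> = Some \<zeta>" using \<xi> by blast
    obtain \<xi>0 \<zeta>0 where \<xi>0: "T \<xi>0 = Some \<zeta>0" "\<zeta>0 - l *\<^sub>C \<xi>0 = \<zeta> - l *\<^sub>C \<xi>"
      using onto by blast
    have \<zeta>0: "T' \<xi>0 = Some \<zeta>0" using ext \<xi>0(1) by (force simp: map_le_def dom_def)
    define x where "x = \<xi> - \<xi>0"
    have "\<xi>0 \<in> dom T'" using \<zeta>0 by blast
    then have x: "x \<in> dom T'"
      unfolding x_def using dom' \<xi> by (intro complex_vector.subspace_diff)
    have lin: "the (T' (u + v)) = the (T' u) + the (T' v)" "the (T' (a *\<^sub>C u)) = a *\<^sub>C the (T' u)"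
      if "u \<in> dom T'" "v \<in> dom T'" for a u v
      using T' that by (simp_all add: linear_operator_def clinear_on_def)
    have "the (T' \<xi>) = the (T' x) + the (T' \<xi>0)"
      using lin(1)[OF x \<open>\<xi>0 \<in> dom T'\<close>] by (simp add: x_def)
    then have "the (T' x) = \<zeta> - \<zeta>0" using \<zeta> \<zeta>0 by simp
    also have "\<dots> = l *\<^sub>C x"
      using \<xi>0(2) by (simp add: x_def complex_vector.scale_right_diff_distrib algebra_simps)
    finally have eigen: "the (T' x) = l *\<^sub>C x" .
    have "x = 0"
    proof (rule ccontr)
      assume "x \<noteq> 0"
      define a where "a = complex_of_real (1 / norm x)"
      have "norm (a *\<^sub>C x) = 1" using \<open>x \<noteq> 0\<close> by (simp add: a_def norm_scaleC norm_divide)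
      moreover have "a *\<^sub>C x \<in> dom T'" using dom' x by (rule complex_vector.subspace_scale)
      moreover have "the (T' (a *\<^sub>C x)) = l *\<^sub>C a *\<^sub>C x"
        using lin(2)[OF x x] eigen by (simp add: scaleC_scaleC mult.commute)
      then have "cinner (the (T' (a *\<^sub>C x))) (a *\<^sub>C x) = l"
        using \<open>norm (a *\<^sub>C x) = 1\<close> by (simp only: cinner_scaleC_left[of l] cinner_self) simp
      ultimately have "l \<in> operator_numerical_range T'"
        unfolding operator_numerical_range_def by force
      then show False using range' l by blast
    qed
    then show ?thesis using \<xi>0(1) by (auto simp: x_def)
  qed
  then show "T = T'"
    using ext by (intro map_le_antisym) (auto simp: map_le_def)
qed


section \<open>Forms shifted by a point away from the numerical range\<close>

lemma form_away_from_numerical_range: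
  assumes V: "csubspace \<D>" and \<Omega>: "sesquilinear_on \<D> \<Omega>"
    and d: "\<And>z. z \<in> form_numerical_range \<D> \<Omega> \<Longrightarrow> d \<le> cmod (z - l)" and \<xi>: "\<xi> \<in> \<D>"
  shows "d * (norm \<xi>)\<^sup>2 \<le> cmod (\<Omega> \<xi> \<xi> - l * cinner \<xi> \<xi>)"
proof (cases "\<xi> = 0")
  case True
  then show ?thesis by simp
next
  case False
  define a where "a = complex_of_real (1 / norm \<xi>)"
  have a\<xi>: "a *\<^sub>C \<xi> \<in> \<D>" using V \<xi> by (rule complex_vector.subspace_scale)
  have "norm (a *\<^sub>C \<xi>) = 1" using False by (simp add: a_def norm_scaleC norm_divide)
  then have "\<Omega> (a *\<^sub>C \<xi>) (a *\<^sub>C \<xi>) \<in> form_numerical_range \<D> \<Omega>"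
    using a\<xi> unfolding form_numerical_range_def by blast
  then have "d \<le> cmod (\<Omega> (a *\<^sub>C \<xi>) (a *\<^sub>C \<xi>) - l)" by (rule d)
  also have "\<Omega> (a *\<^sub>C \<xi>) (a *\<^sub>C \<xi>) = a * cnj a * \<Omega> \<xi> \<xi>"
    using \<Omega> \<xi> a\<xi>
    by (simp add: sesquilinear_on_def clinear_on_def conj_linear_on_def scaleC_complex_def)
  also have "a * cnj a = complex_of_real (1 / (norm \<xi>)\<^sup>2)"
    by (simp add: a_def power2_eq_square)
  also have "complex_of_real (1 / (norm \<xi>)\<^sup>2) * \<Omega> \<xi> \<xi> - l
      = complex_of_real (1 / (norm \<xi>)\<^sup>2) * (\<Omega> \<xi> \<xi> - l * cinner \<xi> \<xi>)"
    using False by (simp add: cinner_self field_simps)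
  also have "cmod \<dots> = cmod (\<Omega> \<xi> \<xi> - l * cinner \<xi> \<xi>) / (norm \<xi>)\<^sup>2"
    by (simp only: norm_mult norm_of_real) simp
  finally show ?thesis using False by (simp add: pos_le_divide_eq)
qed

text \<open>A failure of the bound gives unit vectors \<open>X n\<close> of \<open>N\<close> whose images under the shifted form tend
  to \<open>0\<close>. Testing with \<open>X n\<close> itself shows that \<open>X n\<close> tends to \<open>0\<close> in the Hilbert space, so the shift
  is negligible and \<open>\<Omega> (X n)\<close> tends to \<open>0\<close> too. Ruling out such sequences is the only place where
  the alternatives for \<open>\<Omega>\<close> enter. The condition \<open>K \<ge> 0\<close> covers \<open>\<D> = {0}\<close>, where a negative \<open>K\<close>
  would satisfy the premise as well.\<close>

lemma shifted_form_bounded_below: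
  assumes V: "csubspace \<D>" and \<Omega>: "sesquilinear_on \<D> \<Omega>" and N: "norm_on \<D> N"
    and \<alpha>: "\<And>\<xi>. \<xi> \<in> \<D> \<Longrightarrow> norm \<xi> \<le> \<alpha> * N \<xi>"
    and d: "d > 0" "\<And>z. z \<in> form_numerical_range \<D> \<Omega> \<Longrightarrow> d \<le> cmod (z - l)"
    and no_null_sequence: "\<And>X e. (\<And>n. X n \<in> \<D>) \<Longrightarrow> (\<And>n. N (X n) = 1) \<Longrightarrow> (\<lambda>n. norm (X n)) \<longlonglongrightarrow> 0 \<Longrightarrow>
      (\<And>n \<eta>. \<eta> \<in> \<D> \<Longrightarrow> cmod (\<Omega> (X n) \<eta>) \<le> e n * N \<eta>) \<Longrightarrow> e \<longlonglongrightarrow> 0 \<Longrightarrow> False"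
  shows "\<exists>c>0. \<forall>\<xi>\<in>\<D>. \<forall>K\<ge>0.
    (\<forall>\<eta>\<in>\<D>. cmod (\<Omega> \<xi> \<eta> - l * cinner \<xi> \<eta>) \<le> K * N \<eta>) \<longrightarrow> c * N \<xi> \<le> K"
proof (rule ccontr)
  let ?\<Psi> = "\<lambda>\<xi> \<eta>. \<Omega> \<xi> \<eta> - l * cinner \<xi> \<eta>"
  let ?r = "\<lambda>n. inverse (real (Suc n))"
  assume "\<not> ?thesis"
  then have "\<exists>\<xi>\<in>\<D>. \<exists>K\<ge>0. (\<forall>\<eta>\<in>\<D>. cmod (?\<Psi> \<xi> \<eta>) \<le> K * N \<eta>) \<and> K < c * N \<xi>" if "c > 0" for c
    using that by (meson not_le)
  from this[of "?r _"] have "\<exists>\<xi>\<in>\<D>. \<exists>K\<ge>0. (\<forall>\<eta>\<in>\<D>. cmod (?\<Psi> \<xi> \<eta>) \<le> K * N \<eta>) \<and> K < ?r n * N \<xi>" for n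
    by simp
  then obtain Y K where Y: "\<And>n. Y n \<in> \<D>" and K: "\<And>n. K n \<ge> 0" "\<And>n. K n < ?r n * N (Y n)"
    and Y_le: "\<And>n \<eta>. \<eta> \<in> \<D> \<Longrightarrow> cmod (?\<Psi> (Y n) \<eta>) \<le> K n * N \<eta>"
    by metis
  have pos: "N (Y n) > 0" for n
  proof -
    have "0 < ?r n * N (Y n)" using K[of n] by linarith
    then show ?thesis by (simp add: zero_less_mult_iff)
  qed
  define X where "X n = complex_of_real (1 / N (Y n)) *\<^sub>C Y n" for n
  have X: "X n \<in> \<D>" for n
    unfolding X_def using V Y by (rule complex_vector.subspace_scale)
  have NX: "N (X n) = 1" for n
    using pos[of n] unfolding X_def norm_on_scale[OF N Y] by (simp add: norm_divide)
  have X_le: "cmod (?\<Psi> (X n) \<eta>) \<le> ?r n * N \<eta>" if \<eta>: "\<eta> \<in> \<D>" for n \<eta>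
  proof -
    have "?\<Psi> (X n) \<eta> = complex_of_real (1 / N (Y n)) * ?\<Psi> (Y n) \<eta>"
      using \<Omega> Y[of n] \<eta> unfolding X_def
      by (simp add: sesquilinear_on_def clinear_on_def scaleC_complex_def cinner_scaleC_left
          right_diff_distrib mult.left_commute)
    then have "cmod (?\<Psi> (X n) \<eta>) = cmod (?\<Psi> (Y n) \<eta>) / N (Y n)"
      using pos[of n] by (simp only: norm_mult norm_of_real) simp
    also have "\<dots> \<le> (?r n * N (Y n) * N \<eta>) / N (Y n)"
    proof (rule divide_right_mono)
      have "K n * N \<eta> \<le> ?r n * N (Y n) * N \<eta>"
        using K(2)[of n] norm_on_nonneg[OF N \<eta>] by (intro mult_right_mono) auto
      then show "cmod (?\<Psi> (Y n) \<eta>) \<le> ?r n * N (Y n) * N \<eta>"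
        using Y_le[OF \<eta>, of n] by linarith
    qed (use pos[of n] in simp)
    also have "\<dots> = ?r n * N \<eta>" using pos[of n] by simp
    finally show ?thesis .
  qed
  have X0: "(\<lambda>n. norm (X n)) \<longlonglongrightarrow> 0"
  proof -
    have "(norm (X n))\<^sup>2 \<le> ?r n / d" for n
      using form_away_from_numerical_range[OF V \<Omega> d(2) X, of n] X_le[OF X, of n n] NX[of n] d(1)
      by (simp add: pos_le_divide_eq mult.commute)
    then have bound: "norm ((norm (X n))\<^sup>2) \<le> ?r n / d" for n by simp
    have "(\<lambda>n. ?r n / d) \<longlonglongrightarrow> 0 / d"
      using d(1) by (intro tendsto_intros LIMSEQ_inverse_real_of_nat) simp
    then have "(\<lambda>n. ?r n / d) \<longlonglongrightarrow> 0" by (simp only: div_0)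
    with always_eventually[OF allI[OF bound]]
    have "(\<lambda>n. (norm (X n))\<^sup>2) \<longlonglongrightarrow> 0" by (rule Lim_null_comparison)
    then have "(\<lambda>n. sqrt ((norm (X n))\<^sup>2)) \<longlonglongrightarrow> sqrt 0" by (rule tendsto_real_sqrt)
    then show ?thesis by simp
  qed
  let ?e = "\<lambda>n. ?r n + cmod l * norm (X n) * \<alpha>"
  show False
  proof (rule no_null_sequence[OF X NX X0])
    show "cmod (\<Omega> (X n) \<eta>) \<le> ?e n * N \<eta>" if \<eta>: "\<eta> \<in> \<D>" for n \<eta>
    proof -
      have "cmod (l * cinner (X n) \<eta>) \<le> cmod l * (norm (X n) * (\<alpha> * N \<eta>))"
        unfolding norm_mult using \<alpha>[OF \<eta>]
        by (intro mult_left_mono order_trans[OF cmod_cinner_le]) auto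
      then have "cmod (?\<Psi> (X n) \<eta> + l * cinner (X n) \<eta>) \<le> ?r n * N \<eta> + cmod l * (norm (X n) * (\<alpha> * N \<eta>))"
        by (intro norm_triangle_mono X_le[OF \<eta>])
      then show ?thesis by (simp add: distrib_right mult.assoc)
    qed
    have "?e \<longlonglongrightarrow> 0 + cmod l * 0 * \<alpha>"
      by (intro tendsto_intros LIMSEQ_inverse_real_of_nat X0)
    then show "?e \<longlonglongrightarrow> 0" by simp
  qed
qed

text \<open>Both \<open>\<Omega> (X n)\<close> and \<open>\<Upsilon> (X n)\<close> tend to \<open>0\<close> as functionals, the latter because \<open>\<Upsilon>\<close> is bounded in the
  Hilbert space norm. The supremum is over a nonempty set as \<open>X 0\<close> belongs to it.\<close>

lemma perturbed_form_norm_tendsto_0: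
  assumes \<alpha>: "\<And>\<xi>. \<xi> \<in> \<D> \<Longrightarrow> norm \<xi> \<le> \<alpha> * N \<xi>"
    and \<Upsilon>: "bounded_sesquilinear \<Upsilon>"
    and X: "\<And>n. X n \<in> \<D>" "\<And>n. N (X n) = 1" "(\<lambda>n. norm (X n)) \<longlonglongrightarrow> 0"
    and e: "\<And>n \<eta>. \<eta> \<in> \<D> \<Longrightarrow> cmod (\<Omega> (X n) \<eta>) \<le> e n * N \<eta>" "e \<longlonglongrightarrow> 0"
  shows "(\<lambda>n. SUP \<eta>\<in>{\<eta> \<in> \<D>. N \<eta> = 1}. cmod (\<Omega> (X n) \<eta> + \<Upsilon> (X n) \<eta>)) \<longlonglongrightarrow> 0"
proof -
  obtain C where C: "\<And>\<xi> \<eta>. cmod (\<Upsilon> \<xi> \<eta>) \<le> C * norm \<xi> * norm \<eta>"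
    using \<Upsilon> unfolding bounded_sesquilinear_def by blast
  let ?S = "{\<eta> \<in> \<D>. N \<eta> = 1}" and ?f = "\<lambda>n \<eta>. cmod (\<Omega> (X n) \<eta> + \<Upsilon> (X n) \<eta>)"
  let ?u = "\<lambda>n. e n + \<bar>C\<bar> * norm (X n) * \<alpha>"
  have le: "?f n \<eta> \<le> ?u n" if "\<eta> \<in> ?S" for n \<eta>
  proof (rule norm_triangle_mono)
    show "cmod (\<Omega> (X n) \<eta>) \<le> e n" using e(1)[of \<eta> n] that by simp
    have "C * norm (X n) * norm \<eta> \<le> \<bar>C\<bar> * norm (X n) * norm \<eta>"
      by (intro mult_right_mono) auto
    also have "\<dots> \<le> \<bar>C\<bar> * norm (X n) * \<alpha>"
      using \<alpha>[of \<eta>] that by (intro mult_left_mono) auto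
    finally show "cmod (\<Upsilon> (X n) \<eta>) \<le> \<bar>C\<bar> * norm (X n) * \<alpha>" using C[of "X n" \<eta>] by linarith
  qed
  have "X 0 \<in> ?S" using X by simp
  have upper: "(SUP \<eta>\<in>?S. ?f n \<eta>) \<le> ?u n" for n
    using \<open>X 0 \<in> ?S\<close> le by (intro cSUP_least) blast+
  have lower: "0 \<le> (SUP \<eta>\<in>?S. ?f n \<eta>)" for n
  proof -
    have "?f n (X 0) \<le> (SUP \<eta>\<in>?S. ?f n \<eta>)"
      using \<open>X 0 \<in> ?S\<close> le by (intro cSUP_upper bdd_aboveI2) blast+
    then show ?thesis using norm_ge_zero order_trans by blast
  qed
  have "?u \<longlonglongrightarrow> 0 + \<bar>C\<bar> * 0 * \<alpha>" by (intro tendsto_intros e(2) X(3))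
  then have u0: "?u \<longlonglongrightarrow> 0" by simp
  have bound: "norm (SUP \<eta>\<in>?S. ?f n \<eta>) \<le> ?u n" for n
    using lower[of n] upper[of n] unfolding real_norm_def by linarith
  show ?thesis
    by (rule Lim_null_comparison[OF always_eventually[OF allI[OF bound]] u0])
qed

section \<open>Solvability and maximality\<close>

theorem corollary8p4:
  fixes \<D> :: "'h::chilbert_space set"
    and \<Omega> :: "'h \<Rightarrow> 'h \<Rightarrow> complex"
    and N\<^sub>\<Omega> :: "'h \<Rightarrow> real"
    and \<nn> :: "complex set"
  assumes nn: "\<nn> \<noteq> {}" "\<nn> \<noteq> UNIV" "convex \<nn>"
    and dense_subspace: "csubspace \<D>" "closure \<D> = UNIV"
    and form: "sesquilinear_on \<D> \<Omega>"
    and norm: "norm_on \<D> N\<^sub>\<Omega>"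
    and q_closed: "q_closed \<D> \<Omega> N\<^sub>\<Omega>"
    and range: "form_numerical_range \<D> \<Omega> \<subseteq> \<nn>"
    and alternatives:
      "(\<forall>X :: nat \<Rightarrow> 'h.
          (\<forall>n. X n \<in> \<D>) \<longrightarrow> (\<lambda>n. norm (X n)) \<longlonglongrightarrow> 0 \<longrightarrow> (\<lambda>n. cmod (\<Omega> (X n) (X n))) \<longlonglongrightarrow> 0 \<longrightarrow>
          (\<lambda>n. N\<^sub>\<Omega> (X n)) \<longlonglongrightarrow> 0) \<or>
       (\<exists>\<Upsilon> :: 'h \<Rightarrow> 'h \<Rightarrow> complex.
          bounded_sesquilinear \<Upsilon> \<and>
          form_numerical_range \<D> \<Omega> \<inter> uminus ` form_numerical_range UNIV \<Upsilon> = {} \<and>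
          ((\<forall>X :: nat \<Rightarrow> 'h.
              (\<forall>n. X n \<in> \<D>) \<longrightarrow>
              (\<lambda>n. SUP \<eta>\<in>{\<eta> \<in> \<D>. N\<^sub>\<Omega> \<eta> = 1}. cmod (\<Omega> (X n) \<eta> + \<Upsilon> (X n) \<eta>)) \<longlonglongrightarrow> 0 \<longrightarrow>
              (\<lambda>n. N\<^sub>\<Omega> (X n)) \<longlonglongrightarrow> 0) \<or>
           (\<exists>c>0. \<forall>\<xi>\<in>\<D>.
              c * N\<^sub>\<Omega> \<xi> \<le> (SUP \<eta>\<in>{\<eta> \<in> \<D>. N\<^sub>\<Omega> \<eta> = 1}. cmod (\<Omega> \<xi> \<eta> + \<Upsilon> \<xi> \<eta>)))))"
  shows "solvable \<D> \<Omega> N\<^sub>\<Omega> \<and> maximal_operator \<nn> (associated_operator \<D> \<Omega>)"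
proof
  obtain \<alpha> \<beta> where \<alpha>: "\<And>\<xi>. \<xi> \<in> \<D> \<Longrightarrow> norm \<xi> \<le> \<alpha> * N\<^sub>\<Omega> \<xi>"
    and complete: "complete_on \<D> N\<^sub>\<Omega>" and reflexive: "reflexive_on \<D> N\<^sub>\<Omega>"
    and \<beta>: "\<And>\<xi> \<eta>. \<xi> \<in> \<D> \<Longrightarrow> \<eta> \<in> \<D> \<Longrightarrow> cmod (\<Omega> \<xi> \<eta>) \<le> \<beta> * N\<^sub>\<Omega> \<xi> * N\<^sub>\<Omega> \<eta>"
    using q_closed unfolding q_closed_def by blast
  have "closure \<nn> \<noteq> UNIV"
    using nn(2) convex_interior_closure[OF nn(3)] interior_subset[of \<nn>] by auto
  then obtain l where l: "l \<notin> closure \<nn>" by blast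
  then have l_nn: "l \<notin> \<nn>" using closure_subset by blast
  obtain d where d: "d > 0" "\<And>z. z \<in> \<nn> \<Longrightarrow> d \<le> cmod (z - l)"
    using l unfolding closure_approachable dist_norm by (meson not_le)
  define \<Psi> where "\<Psi> \<xi> \<eta> = \<Omega> \<xi> \<eta> - l * cinner \<xi> \<eta>" for \<xi> \<eta>
  \<comment> \<open>Each alternative excludes unit vectors for the norm of \<open>\<Omega>\<close> that vanish in the limit both in the
    Hilbert space and, through \<open>\<Omega>\<close>, as functionals.\<close>
  have no_null_sequence: False
    if X: "\<And>n. X n \<in> \<D>" "\<And>n. N\<^sub>\<Omega> (X n) = 1" "(\<lambda>n. norm (X n)) \<longlonglongrightarrow> 0"
      and e: "\<And>n \<eta>. \<eta> \<in> \<D> \<Longrightarrow> cmod (\<Omega> (X n) \<eta>) \<le> e n * N\<^sub>\<Omega> \<eta>" "e \<longlonglongrightarrow> 0"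
    for X :: "nat \<Rightarrow> 'h" and e
  proof -
    have NX: "\<not> (\<lambda>n. N\<^sub>\<Omega> (X n)) \<longlonglongrightarrow> 0"
      using X(2) LIMSEQ_unique[OF tendsto_const[of "1::real"], of 0] by auto
    from alternatives show False
    proof (elim disjE exE conjE)
      assume i: "\<forall>X. (\<forall>n. X n \<in> \<D>) \<longrightarrow> (\<lambda>n. norm (X n)) \<longlonglongrightarrow> 0 \<longrightarrow>
        (\<lambda>n. cmod (\<Omega> (X n) (X n))) \<longlonglongrightarrow> 0 \<longrightarrow> (\<lambda>n. N\<^sub>\<Omega> (X n)) \<longlonglongrightarrow> 0"
      have "cmod (\<Omega> (X n) (X n)) \<le> e n" for n using e(1)[OF X(1), of n n] X(2)[of n] by simp
      then have bound: "norm (cmod (\<Omega> (X n) (X n))) \<le> e n" for n by simp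
      have "(\<lambda>n. cmod (\<Omega> (X n) (X n))) \<longlonglongrightarrow> 0"
        by (rule Lim_null_comparison[OF always_eventually[OF allI[OF bound]] e(2)])
      then show False using i X(1,3) NX by blast
    next
      fix \<Upsilon> :: "'h \<Rightarrow> 'h \<Rightarrow> complex"
      assume \<Upsilon>: "bounded_sesquilinear \<Upsilon>"
        and ii': "\<forall>X. (\<forall>n. X n \<in> \<D>) \<longrightarrow>
          (\<lambda>n. SUP \<eta>\<in>{\<eta> \<in> \<D>. N\<^sub>\<Omega> \<eta> = 1}. cmod (\<Omega> (X n) \<eta> + \<Upsilon> (X n) \<eta>)) \<longlonglongrightarrow> 0 \<longrightarrow>
          (\<lambda>n. N\<^sub>\<Omega> (X n)) \<longlonglongrightarrow> 0"
      have "(\<lambda>n. SUP \<eta>\<in>{\<eta> \<in> \<D>. N\<^sub>\<Omega> \<eta> = 1}. cmod (\<Omega> (X n) \<eta> + \<Upsilon> (X n) \<eta>)) \<longlonglongrightarrow> 0"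
        by (rule perturbed_form_norm_tendsto_0[OF \<alpha> \<Upsilon> X e])
      then show False using ii' X(1) NX by blast
    next
      fix \<Upsilon> :: "'h \<Rightarrow> 'h \<Rightarrow> complex" and c :: real
      assume \<Upsilon>: "bounded_sesquilinear \<Upsilon>" and c: "0 < c"
        and ii'': "\<forall>\<xi>\<in>\<D>. c * N\<^sub>\<Omega> \<xi> \<le>
          (SUP \<eta>\<in>{\<eta> \<in> \<D>. N\<^sub>\<Omega> \<eta> = 1}. cmod (\<Omega> \<xi> \<eta> + \<Upsilon> \<xi> \<eta>))"
      have "(\<lambda>n. SUP \<eta>\<in>{\<eta> \<in> \<D>. N\<^sub>\<Omega> \<eta> = 1}. cmod (\<Omega> (X n) \<eta> + \<Upsilon> (X n) \<eta>)) \<longlonglongrightarrow> 0"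
        by (rule perturbed_form_norm_tendsto_0[OF \<alpha> \<Upsilon> X e])
      moreover have "c \<le> (SUP \<eta>\<in>{\<eta> \<in> \<D>. N\<^sub>\<Omega> \<eta> = 1}. cmod (\<Omega> (X n) \<eta> + \<Upsilon> (X n) \<eta>))" for n
        using ii'' X(1,2)[of n] by fastforce
      ultimately have "c \<le> 0" by (intro LIMSEQ_le_const) auto
      then show False using c by simp
    qed
  qed
  have d': "d \<le> cmod (z - l)" if "z \<in> form_numerical_range \<D> \<Omega>" for z
    using d(2) range that by blast
  have "\<exists>c>0. \<forall>\<xi>\<in>\<D>. \<forall>K\<ge>0.
    (\<forall>\<eta>\<in>\<D>. cmod (\<Omega> \<xi> \<eta> - l * cinner \<xi> \<eta>) \<le> K * N\<^sub>\<Omega> \<eta>) \<longrightarrow> c * N\<^sub>\<Omega> \<xi> \<le> K"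
  proof (rule shifted_form_bounded_below[OF dense_subspace(1) form norm \<alpha> d(1) d'])
    fix X e
    assume "\<And>n. X n \<in> \<D>" "\<And>n. N\<^sub>\<Omega> (X n) = 1" "(\<lambda>n. norm (X n)) \<longlonglongrightarrow> 0"
      "\<And>n \<eta>. \<eta> \<in> \<D> \<Longrightarrow> cmod (\<Omega> (X n) \<eta>) \<le> e n * N\<^sub>\<Omega> \<eta>" "e \<longlonglongrightarrow> 0"
    then show False by (rule no_null_sequence)
  qed
  then obtain c where c: "c > 0"
    and below: "\<And>\<xi> K. \<xi> \<in> \<D> \<Longrightarrow> 0 \<le> K \<Longrightarrow> (\<And>\<eta>. \<eta> \<in> \<D> \<Longrightarrow> cmod (\<Psi> \<xi> \<eta>) \<le> K * N\<^sub>\<Omega> \<eta>) \<Longrightarrow> c * N\<^sub>\<Omega> \<xi> \<le> K"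
    unfolding \<Psi>_def by blast
  have nondegenerate: "\<xi> = 0" if "\<xi> \<in> \<D>" "\<Psi> \<xi> \<xi> = 0" for \<xi>
    using form_away_from_numerical_range[OF dense_subspace(1) form d' that(1)] that(2) d(1)
    by (simp add: \<Psi>_def mult_le_0_iff)
  have \<Psi>: "sesquilinear_on \<D> \<Psi>"
    using form unfolding \<Psi>_def
    by (simp add: sesquilinear_on_def clinear_on_def conj_linear_on_def scaleC_complex_def
        cinner_add_left cinner_add_right cinner_scaleC_left cinner_scaleC_right algebra_simps)
  have bounded: "cmod (\<Psi> \<xi> \<eta>) \<le> (\<beta> + cmod l * \<alpha> * \<alpha>) * N\<^sub>\<Omega> \<xi> * N\<^sub>\<Omega> \<eta>"
    if \<xi>: "\<xi> \<in> \<D>" and \<eta>: "\<eta> \<in> \<D>" for \<xi> \<eta>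
  proof -
    have "cmod (cinner \<xi> \<eta>) \<le> norm \<xi> * norm \<eta>" by (rule cmod_cinner_le)
    also have "\<dots> \<le> (\<alpha> * N\<^sub>\<Omega> \<xi>) * (\<alpha> * N\<^sub>\<Omega> \<eta>)"
      using \<alpha>[OF \<xi>] \<alpha>[OF \<eta>] norm_ge_zero[of \<xi>] norm_ge_zero[of \<eta>] by (intro mult_mono) linarith+
    finally have "cmod (l * cinner \<xi> \<eta>) \<le> cmod l * ((\<alpha> * N\<^sub>\<Omega> \<xi>) * (\<alpha> * N\<^sub>\<Omega> \<eta>))"
      unfolding norm_mult by (intro mult_left_mono) auto
    then have "cmod (\<Psi> \<xi> \<eta>) \<le> \<beta> * N\<^sub>\<Omega> \<xi> * N\<^sub>\<Omega> \<eta> + cmod l * ((\<alpha> * N\<^sub>\<Omega> \<xi>) * (\<alpha> * N\<^sub>\<Omega> \<eta>))"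
      unfolding \<Psi>_def using \<beta>[OF \<xi> \<eta>] norm_triangle_ineq4[of "\<Omega> \<xi> \<eta>" "l * cinner \<xi> \<eta>"] by linarith
    then show ?thesis by (simp add: algebra_simps)
  qed
  have surjective: "\<exists>\<xi>\<in>\<D>. \<forall>\<eta>\<in>\<D>. \<Lambda> \<eta> = \<Psi> \<xi> \<eta>" if "\<Lambda> \<in> conj_dual_space \<D> N\<^sub>\<Omega>" for \<Lambda>
    by (rule reflexive_form_surjective[OF dense_subspace(1) norm complete reflexive \<Psi> bounded c
          below _ that]) (use nondegenerate in blast)+
  have "(\<lambda>\<xi> \<eta>. - l * cinner \<xi> \<eta>) \<in> solving_perturbations \<D> \<Omega> N\<^sub>\<Omega>"
    unfolding solving_perturbations_def
    using bounded_sesquilinear_cinner[of "- l"] nondegenerate surjective by (simp add: \<Psi>_def)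
  then show "solvable \<D> \<Omega> N\<^sub>\<Omega>" using q_closed unfolding solvable_def by blast
  show "maximal_operator \<nn> (associated_operator \<D> \<Omega>)"
  proof (rule maximal_operatorI[OF _ _ l_nn])
    show "linear_operator (associated_operator \<D> \<Omega>)"
      using dense_subspace form by (rule linear_operator_associated_operator)
    show "operator_numerical_range (associated_operator \<D> \<Omega>) \<subseteq> \<nn>"
      using operator_numerical_range_associated_operator[OF dense_subspace(2)] range by blast
    fix \<kappa> :: 'h
    define \<Lambda> where "\<Lambda> \<eta> = (if \<eta> \<in> \<D> then cinner \<kappa> \<eta> else 0)" for \<eta>
    have "cmod (\<Lambda> \<eta>) \<le> (norm \<kappa> * \<alpha>) * N\<^sub>\<Omega> \<eta>" if "\<eta> \<in> \<D>" for \<eta>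
    proof -
      have "cmod (\<Lambda> \<eta>) \<le> norm \<kappa> * norm \<eta>" using that cmod_cinner_le by (simp add: \<Lambda>_def)
      also have "\<dots> \<le> norm \<kappa> * (\<alpha> * N\<^sub>\<Omega> \<eta>)" using \<alpha>[OF that] by (intro mult_left_mono) auto
      finally show ?thesis by (simp only: mult.assoc)
    qed
    then have "bounded_on \<D> N\<^sub>\<Omega> \<Lambda>" unfolding bounded_on_def by blast
    moreover have "conj_linear_on \<D> \<Lambda>"
      using dense_subspace(1)
      by (simp add: \<Lambda>_def conj_linear_on_def cinner_add_right cinner_scaleC_right
          scaleC_complex_def complex_vector.subspace_add complex_vector.subspace_scale)
    ultimately have "\<Lambda> \<in> conj_dual_space \<D> N\<^sub>\<Omega>" by (simp add: conj_dual_space_def \<Lambda>_def)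
    then obtain \<xi> where \<xi>: "\<xi> \<in> \<D>" "\<And>\<eta>. \<eta> \<in> \<D> \<Longrightarrow> \<Lambda> \<eta> = \<Psi> \<xi> \<eta>" using surjective by blast
    have "\<Omega> \<xi> \<eta> = cinner (\<kappa> + l *\<^sub>C \<xi>) \<eta>" if "\<eta> \<in> \<D>" for \<eta>
      using \<xi>(2)[OF that] that by (simp add: \<Lambda>_def \<Psi>_def cinner_add_left cinner_scaleC_left)
    then have "associated_operator \<D> \<Omega> \<xi> = Some (\<kappa> + l *\<^sub>C \<xi>)"
      using \<xi>(1) by (simp add: associated_operator_eq_Some_iff[OF dense_subspace(2)])
    then show "\<exists>\<xi> \<zeta>. associated_operator \<D> \<Omega> \<xi> = Some \<zeta> \<and> \<zeta> - l *\<^sub>C \<xi> = \<kappa>" by force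
  qed
qed

end
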